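(* Let $n\ge0$ and let $W(t)=(W_0(t),\dots,W_n(t))$, $t\ge 0$, where $W_0=B$ is a standard Brownian motion and $W_k(t)=\int_0^tW_{k-1}(s)\,ds$ for $1\le k\le n$. For $t>0$ and $a,w\in\mathbb{R}^{n+1}$, let $\pi_a(w,t)$ be the transition density of $W$, i.e. $\pi_a(w,t)\,dw=P(W(t+s)\in dw\mid W(s)=a)$ (which does not depend on $s\ge0$). Then $$\pi_a(w,t)=t^{-\frac12(n+1)^2}\,p_n\big(T(t)w-\Gamma T(t)a\big)=t^{-\frac12(n+1)^2}K_n\,e^{-\frac12[AT(t)w-A^*T(t)a]'\,\Lambda\,[AT(t)w-A^*T(t)a]},$$ where the normalizing constants $K_n$ are given by $$K_n=\frac{1}{(2\pi)^{(n+1)/2}}\sqrt{\frac{(2n+1)!}{2^n\,n!}}\left(\prod_{m=0}^{n}\frac{(2m)!}{m!}\right).$$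
   Context: All matrices are $(n+1)\times(n+1)$ with rows and columns numbered from $0$ to $n$; vectors are column vectors and $'$ denotes transpose. Notation: - $p_n$ is the joint density on $\mathbb{R}^{n+1}$ of $(X_0(t),\dots,X_n(t))$, where $X_k(t)=e^{-(k+\frac12)t}W_k(e^t)$, $t\in\mathbb{R}$; these processes are jointly stationary, so $p_n$ does not depend on $t$. - $T(t)$ is the diagonal matrix with entries $(T(t))_{kk}=t^{-(k+\frac12)}$. - $\Lambda$ is the diagonal matrix with entries $(\Lambda)_{kk}=2k+1$. - $\Gamma$ is the lower triangular matrix with $\Gamma_{jk}=\frac{1}{(j-k)!}$ for $j\ge k$ and $\Gamma_{jk}=0$ for $j<k$. - $A$ is the lower triangular matrix with $A_{jk}=(-1)^{j+k}\frac{(j+k)!}{k!\,(j-k)!}$ for $j\ge k$ and $A_{jk}=0$ for $j<k$. - For a matrix $M$, $M^*$ is the matrix with $(M^* )_{jk}=(-1)^{j+k}M_{jk}$; thus $(A^* )_{jk}=\frac{(j+k)!}{k!\,(j-k)!}$ for $j\ge k$ and $0$ otherwise. *)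

theory Defs
  imports "HOL-Probability.Probability"
begin

text \<open>
  Vectors of $\mathbb{R}^{n+1}$, with coordinates numbered from 0 to n, are the extensional functions
  on \<open>{..n}\<close>; they form the space of the product measure \<open>lborel_vec n\<close>, and their topology is the
  one inherited from the product topology of \<open>nat \<Rightarrow> real\<close>. A matrix is a function
  \<open>nat \<Rightarrow> nat \<Rightarrow> real\<close> of which only the entries with both indices at most n are used.
\<close>

abbreviation vecs :: "nat \<Rightarrow> (nat \<Rightarrow> real) set" where
  "vecs n \<equiv> {..n} \<rightarrow>\<^sub>E UNIV"

abbreviation lborel_vec :: "nat \<Rightarrow> (nat \<Rightarrow> real) measure" where
  "lborel_vec n \<equiv> (\<Pi>\<^sub>M k\<in>{..n}. lborel)"

definition mat_vec :: "nat \<Rightarrow> (nat \<Rightarrow> nat \<Rightarrow> real) \<Rightarrow> (nat \<Rightarrow> real) \<Rightarrow> nat \<Rightarrow> real" where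
  "mat_vec n M v = (\<lambda>j\<in>{..n}. \<Sum>k\<le>n. M j k * v k)"

definition vec_diff :: "nat \<Rightarrow> (nat \<Rightarrow> real) \<Rightarrow> (nat \<Rightarrow> real) \<Rightarrow> nat \<Rightarrow> real" where
  "vec_diff n u v = (\<lambda>j\<in>{..n}. u j - v j)"

definition vec_inner :: "nat \<Rightarrow> (nat \<Rightarrow> real) \<Rightarrow> (nat \<Rightarrow> real) \<Rightarrow> real" where
  "vec_inner n u v = (\<Sum>j\<le>n. u j * v j)"

definition T_mat :: "real \<Rightarrow> nat \<Rightarrow> nat \<Rightarrow> real" where
  "T_mat t j k = (if j = k then t powr (- (real k + 1/2)) else 0)"

definition Lambda_mat :: "nat \<Rightarrow> nat \<Rightarrow> real" where
  "Lambda_mat j k = (if j = k then 2 * real k + 1 else 0)"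

definition Gamma_mat :: "nat \<Rightarrow> nat \<Rightarrow> real" where
  "Gamma_mat j k = (if k \<le> j then 1 / fact (j - k) else 0)"

definition A_mat :: "nat \<Rightarrow> nat \<Rightarrow> real" where
  "A_mat j k = (if k \<le> j then (-1) ^ (j + k) * fact (j + k) / (fact k * fact (j - k)) else 0)"

definition star_mat :: "(nat \<Rightarrow> nat \<Rightarrow> real) \<Rightarrow> nat \<Rightarrow> nat \<Rightarrow> real" where
  "star_mat M j k = (-1) ^ (j + k) * M j k"

definition K_const :: "nat \<Rightarrow> real" where
  "K_const n = 1 / (2 * pi) powr ((real n + 1) / 2)
     * sqrt (fact (2 * n + 1) / (2 ^ n * fact n)) * (\<Prod>m=0..n. fact (2 * m) / fact m)"

text \<open>Only times \<open>t \<ge> 0\<close> are constrained; \<open>normal_density\<close> takes the standard deviation.\<close>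

locale standard_brownian_motion = prob_space M for M :: "'a measure" +
  fixes B :: "real \<Rightarrow> 'a \<Rightarrow> real"
  assumes random_variable_B: "0 \<le> t \<Longrightarrow> random_variable borel (B t)"
    and starts_at_0: "AE \<omega> in M. B 0 \<omega> = 0"
    and independent_increments:
      "0 \<le> \<tau> 0 \<Longrightarrow> (\<And>i. i < m \<Longrightarrow> \<tau> i \<le> \<tau> (Suc i)) \<Longrightarrow>
       indep_vars (\<lambda>_. borel) (\<lambda>i \<omega>. B (\<tau> (Suc i)) \<omega> - B (\<tau> i) \<omega>) {..<m::nat}"
    and normal_increments:
      "0 \<le> s \<Longrightarrow> s < t \<Longrightarrow>
       distributed M lborel (\<lambda>\<omega>. B t \<omega> - B s \<omega>) (normal_density 0 (sqrt (t - s)))"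
    and continuous_paths: "\<omega> \<in> space M \<Longrightarrow> continuous_on {0..} (\<lambda>t. B t \<omega>)"

primrec iter_int :: "(real \<Rightarrow> 'a \<Rightarrow> real) \<Rightarrow> nat \<Rightarrow> real \<Rightarrow> 'a \<Rightarrow> real" where
  "iter_int B 0 t \<omega> = B t \<omega>"
| "iter_int B (Suc k) t \<omega> = integral {0..t} (\<lambda>s. iter_int B k s \<omega>)"

definition W_vec :: "(real \<Rightarrow> 'a \<Rightarrow> real) \<Rightarrow> nat \<Rightarrow> real \<Rightarrow> 'a \<Rightarrow> nat \<Rightarrow> real" where
  "W_vec B n t \<omega> = (\<lambda>k\<in>{..n}. iter_int B k t \<omega>)"

definition X_vec :: "(real \<Rightarrow> 'a \<Rightarrow> real) \<Rightarrow> nat \<Rightarrow> real \<Rightarrow> 'a \<Rightarrow> nat \<Rightarrow> real" where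
  "X_vec B n t \<omega> = (\<lambda>k\<in>{..n}. exp (- (real k + 1/2) * t) * iter_int B k (exp t) \<omega>)"

text \<open>
  Densities are determined only up to null sets, so an identity between their values at given
  points refers to their continuous versions. Continuity is therefore part of the next two
  definitions.
\<close>

definition is_stationary_density ::
  "'a measure \<Rightarrow> (real \<Rightarrow> 'a \<Rightarrow> real) \<Rightarrow> nat \<Rightarrow> ((nat \<Rightarrow> real) \<Rightarrow> real) \<Rightarrow> bool" where
  "is_stationary_density M B n p \<longleftrightarrow>
     (\<forall>x\<in>vecs n. 0 \<le> p x) \<and> continuous_on (vecs n) p \<and>
     (\<forall>t. distributed M (lborel_vec n) (X_vec B n t) p)"

text \<open>
  The condition that \<open>P(W(t+s) \<in> D | W(s) = a)\<close> is the integral of \<open>\<pi> a w t\<close> over \<open>w \<in> D\<close> is stated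
  as an almost sure identity for the conditional probability of \<open>W(t+s) \<in> D\<close> given the
  sigma-algebra generated by \<open>W(s)\<close>. One and the same \<open>\<pi>\<close> has to serve for all \<open>s \<ge> 0\<close>.
\<close>

definition is_transition_density ::
  "'a measure \<Rightarrow> (real \<Rightarrow> 'a \<Rightarrow> real) \<Rightarrow> nat \<Rightarrow>
   ((nat \<Rightarrow> real) \<Rightarrow> (nat \<Rightarrow> real) \<Rightarrow> real \<Rightarrow> real) \<Rightarrow> bool" where
  "is_transition_density M B n \<pi> \<longleftrightarrow>
     (\<forall>t>0.
        (\<forall>a\<in>vecs n. \<forall>w\<in>vecs n. 0 \<le> \<pi> a w t) \<and>
        continuous_on (vecs n \<times> vecs n) (\<lambda>(a, w). \<pi> a w t) \<and>
        (\<forall>s\<ge>0. \<forall>D\<in>sets (lborel_vec n). AE \<omega> in M.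
           nn_cond_exp M (vimage_algebra (space M) (W_vec B n s) (lborel_vec n))
             (indicator {\<omega>\<in>space M. W_vec B n (t + s) \<omega> \<in> D}) \<omega>
           = (\<integral>\<^sup>+w\<in>D. ennreal (\<pi> (W_vec B n s \<omega>) w t) \<partial>lborel_vec n)))"

end

theory Submission
  imports Defs
begin

text \<open>
  Taylor's formula for the iterated integrals on \<open>[s, s + t]\<close> reads
  \<open>W\<^sub>k(s + t) = (\<Sum>j\<le>k. t^(k - j) / (k - j)! * W\<^sub>j(s)) + I\<^sub>k\<close>, where \<open>I\<^sub>k\<close> is the Wiener integral of
  \<open>(s + t - u)^k / k!\<close> with respect to \<open>B\<close> over \<open>[s, s + t]\<close>. The integrals \<open>I\<^sub>k\<close> depend only on
  increments of \<open>B\<close> after time \<open>s\<close>, so they are independent of \<open>W(s)\<close>, and they form a centred Gaussian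
  vector with covariances \<open>t^(j + k + 1) / ((j + k + 1) j! k!)\<close>. Hence the transition density from \<open>a\<close>
  is the density of this Gaussian vector, translated by the Taylor polynomial of \<open>a\<close>.

  For \<open>t = 1\<close> the covariance matrix is the Gram matrix of the monomials \<open>x^k / k!\<close> in \<open>L\<^sup>2[0, 1]\<close>, and
  the rows of \<open>A\<close> are the coefficients, in this basis, of the shifted Legendre polynomials \<open>P\<^sub>j\<close>. These are
  orthogonal with squared norms \<open>1 / (2 j + 1)\<close> (lemma \<open>A_mat_orthogonal\<close>), so the numbers
  \<open>sqrt (2 j + 1) (A T(t) I)\<^sub>j\<close> are independent standard normal variables. The transformation is
  triangular; its determinant is the product of its diagonal entries, which produces both \<open>K\<^sub>n\<close> and
  the power of \<open>t\<close> (lemmas \<open>distributed_scaled_kernel\<close> and \<open>scaled_kernel_std\<close>). The scaling \<open>T(t)\<close>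
  turns the Taylor polynomial of \<open>a\<close> into \<open>\<Gamma> T(t) a\<close> (lemma \<open>scaled_kernel_shift\<close>), and \<open>A \<Gamma> = A\<^sup>*\<close>
  (lemma \<open>A_mat_Gamma_mat\<close>) is the symmetry \<open>P\<^sub>j(1 + y) = (-1)^j P\<^sub>j(- y)\<close>.

  Gaussianity and independence are both obtained from characteristic functions. Along each path the
  Wiener integrals are limits of finite sums over increments of \<open>B\<close>
  (lemma \<open>iter_int_increment_limit\<close>), which gives the joint characteristic function of \<open>W(s)\<close> and
  \<open>I\<close> (lemma \<open>char_state_innovation\<close>); a vector-valued version of Levy's uniqueness theorem
  (theorem \<open>joint_char_unique\<close>) turns it into a statement about laws.

  Finally, two continuous densities that are equal almost everywhere are equal everywhere, because a
  strict inequality at one point would persist on a box of positive measure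
  (lemma \<open>separating_boxes\<close>). For transition densities the starting points fill such a box with
  positive probability, since the density of \<open>W(1)\<close> is positive everywhere.
\<close>

section \<open>Shifted Legendre polynomials\<close>

lemma prod_shift_fact: "(\<Prod>m=1..j. real (c + m)) = fact (c + j) / fact c"
proof (induction j)
  case (Suc j)
  have "(\<Prod>m=1..Suc j. real (c + m)) = fact (c + j) / fact c * real (c + Suc j)"
    using Suc.IH by simp
  then show ?case by simp
qed simp

text \<open>
  For \<open>x > 0\<close> the left-hand side is the moment \<open>\<integral>\<^sub>0\<^sup>1 P\<^sub>j(u) u^(x - 1) du\<close> of the shifted Legendre
  polynomial \<open>P\<^sub>j\<close>, and the right-hand side shows its zeros at \<open>x = 1, \<dots>, j\<close>, which express the
  orthogonality of \<open>P\<^sub>j\<close> to all lower powers. Passing from \<open>j\<close> to \<open>j + 1\<close> multiplies the right-hand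
  side by \<open>(x - (j + 1)) / (x + (j + 1))\<close>; splitting each term into partial fractions gives the
  recursion of the coefficients, and the coefficient of the new pole is a multiple of the
  value of the old sum at \<open>x = - (j + 1)\<close>.
\<close>

lemma shifted_legendre_partial_fractions:
  fixes x :: real
  assumes "\<And>m. m \<le> j \<Longrightarrow> x + real m \<noteq> 0"
  shows "(\<Sum>k\<le>j. A_mat j k / fact k / (x + real k))
    = (\<Prod>m=1..j. x - real m) / (\<Prod>m\<le>j. x + real m)"
  using assms
proof (induction j arbitrary: x)
  case 0
  then show ?case by (simp add: A_mat_def)
next
  case (Suc j)
  let ?y = "- (real j + 1)"
  define F where "F = (\<lambda>x. (\<Prod>m=1..j. x - real m) / (\<Prod>m\<le>j. x + real m))"
  have rec: "A_mat (Suc j) k = - A_mat j k * (real j + real k + 1) / (real j + 1 - real k)" if "k \<le> j" for k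
  proof -
    have "Suc j - k = Suc (j - k)" using that by simp
    with that have *: "A_mat (Suc j) k = - ((-1)^(j + k) * ((real j + real k + 1) * fact (j + k)) / (fact k * ((real j + 1 - real k) * fact (j - k))))"
      by (simp add: A_mat_def of_nat_diff add_ac)
    show ?thesis
      unfolding * using that by (simp add: A_mat_def mult_ac)
  qed
  have split: "a / (x + real k) * ((x - (real j + 1)) / (x + (real j + 1)))
     = (- a * (real j + real k + 1) / (real j + 1 - real k)) / (x + real k)
       + (2 * (real j + 1) * (a / (real j + 1 - real k))) / (x + (real j + 1))" if "k \<le> j" for k a
  proof -
    have "x + real k \<noteq> 0" "x + (real j + 1) \<noteq> 0" "real j + 1 - real k \<noteq> 0"
      using Suc.prems[of k] Suc.prems[of "Suc j"] that by (auto simp: algebra_simps)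
    then show ?thesis by (simp add: divide_simps) (simp add: algebra_simps)
  qed
  have "(\<Prod>m=1..j. ?y - real m) = (\<Prod>m=1..j. (-1) * real (Suc j + m))"
    by (intro prod.cong) auto
  also have "\<dots> = (-1)^j * (fact (Suc j + j) / fact (Suc j))"
    by (subst prod.distrib) (simp add: prod_shift_fact[of "Suc j" j, simplified])
  finally have num: "(\<Prod>m=1..j. ?y - real m) = (-1)^j * (fact (Suc j + j) / fact (Suc j))" .
  have "(\<Prod>m\<le>j. ?y + real m) = (\<Prod>m\<le>j. ?y + real (j - m))"
    by (rule prod.nat_diff_reindex[where n="Suc j", simplified lessThan_Suc_atMost, symmetric, simplified])
  also have "\<dots> = (\<Prod>m\<le>j. (-1) * real (Suc m))"
    by (intro prod.cong) (auto simp: of_nat_diff)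
  also have "\<dots> = (-1)^(Suc j) * (\<Prod>m\<le>j. real (Suc m))"
    by (subst prod.distrib) simp
  also have "(\<Prod>m\<le>j. real (Suc m)) = fact (Suc j)"
    by (induction j) auto
  finally have den: "(\<Prod>m\<le>j. ?y + real m) = (-1)^(Suc j) * fact (Suc j)" .
  have "(\<Sum>k\<le>j. A_mat j k / fact k / (real j + 1 - real k)) = - (\<Sum>k\<le>j. A_mat j k / fact k / (?y + real k))"
    unfolding sum_negf[symmetric]
    by (intro sum.cong refl) (auto simp: divide_simps algebra_simps)
  also have "\<dots> = - F ?y"
    unfolding F_def by (subst Suc.IH) auto
  also have "\<dots> = fact (Suc j + j) / (fact (Suc j) * fact (Suc j))"
  proof -
    have "(-1)^j * a / ((-1)^(Suc j) * b) = - (a / b)" for a b :: real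
      by (cases "even j") auto
    then show ?thesis unfolding F_def num den by simp
  qed
  finally have top: "2 * (real j + 1) * (\<Sum>k\<le>j. A_mat j k / fact k / (real j + 1 - real k))
      = A_mat (Suc j) (Suc j) / fact (Suc j)"
    by (simp add: A_mat_def field_simps)
  have "(\<Prod>m=1..Suc j. x - real m) / (\<Prod>m\<le>Suc j. x + real m)
      = F x * ((x - (real j + 1)) / (x + (real j + 1)))"
    by (simp add: F_def add.commute)
  also have "F x = (\<Sum>k\<le>j. A_mat j k / fact k / (x + real k))"
    unfolding F_def by (rule Suc.IH[symmetric]) (use Suc.prems in auto)
  also have "\<dots> * ((x - (real j + 1)) / (x + (real j + 1)))
      = (\<Sum>k\<le>j. A_mat (Suc j) k / fact k / (x + real k)
            + (2 * (real j + 1) * (A_mat j k / fact k / (real j + 1 - real k))) / (x + (real j + 1)))"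
    unfolding sum_distrib_right
  proof (intro sum.cong refl)
    fix k assume "k \<in> {..j}"
    then have k: "k \<le> j" by simp
    show "A_mat j k / fact k / (x + real k) * ((x - (real j + 1)) / (x + (real j + 1)))
      = A_mat (Suc j) k / fact k / (x + real k)
          + (2 * (real j + 1) * (A_mat j k / fact k / (real j + 1 - real k))) / (x + (real j + 1))"
      unfolding split[OF k] rec[OF k] by (simp add: mult_ac)
  qed
  also have "\<dots> = (\<Sum>k\<le>j. A_mat (Suc j) k / fact k / (x + real k))
      + (2 * (real j + 1) * (\<Sum>k\<le>j. A_mat j k / fact k / (real j + 1 - real k))) / (x + (real j + 1))"
    by (simp only: sum.distrib sum_distrib_left sum_divide_distrib)
  finally show ?case
    unfolding top by (simp add: add.commute)
qed

text \<open>
  The inner sum over \<open>l\<close> is the moment of \<open>P\<^sub>j\<close> of order \<open>k\<close>, which vanishes for \<open>k < j\<close>. For \<open>i \<le> j\<close>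
  the coefficients of \<open>P\<^sub>i\<close> vanish in degrees \<open>k > j\<close>, so that only \<open>k = j\<close> can contribute, and it does
  so only for \<open>i = j\<close>.
\<close>

lemma A_mat_orthogonal:
  assumes "i \<le> n" "j \<le> n"
  shows "(\<Sum>k\<le>n. \<Sum>l\<le>n. A_mat i k * A_mat j l / (real (k + l + 1) * fact k * fact l))
     = (if i = j then 1 / (2 * real j + 1) else 0)"
proof -
  have moment: "(\<Sum>l\<le>n. A_mat j l / fact l / (real (Suc k) + real l))
      = (\<Prod>m=1..j. real (Suc k) - real m) / (\<Prod>m\<le>j. real (Suc k) + real m)" if "j \<le> n" for j k
  proof -
    have "(\<Sum>l\<le>n. A_mat j l / fact l / (real (Suc k) + real l)) = (\<Sum>l\<le>j. A_mat j l / fact l / (real (Suc k) + real l))"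
      using that by (intro sum.mono_neutral_right) (auto simp: A_mat_def)
    then show ?thesis by (subst shifted_legendre_partial_fractions[symmetric]) auto
  qed
  have vanish: "(\<Sum>l\<le>n. A_mat j l / fact l / (real (Suc k) + real l)) = 0" if "j \<le> n" "k < j" for j k
    unfolding moment[OF that(1)] using that(2) by (auto intro!: prod_zero bexI[of _ "Suc k"])
  have *: "(\<Sum>k\<le>n. \<Sum>l\<le>n. A_mat i k * A_mat j l / (real (k + l + 1) * fact k * fact l))
     = (if i = j then 1 / (2 * real j + 1) else 0)" if "i \<le> j" "j \<le> n" for i j
  proof -
    have "(\<Sum>k\<le>n. \<Sum>l\<le>n. A_mat i k * A_mat j l / (real (k + l + 1) * fact k * fact l))
      = (\<Sum>k\<le>n. A_mat i k / fact k * (\<Sum>l\<le>n. A_mat j l / fact l / (real (Suc k) + real l)))"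
      unfolding sum_distrib_left by (intro sum.cong refl) (simp add: field_simps)
    also have "\<dots> = (\<Sum>k\<in>{j}. A_mat i k / fact k * (\<Sum>l\<le>n. A_mat j l / fact l / (real (Suc k) + real l)))"
    proof (rule sum.mono_neutral_right)
      show "\<forall>k\<in>{..n} - {j}. A_mat i k / fact k * (\<Sum>l\<le>n. A_mat j l / fact l / (real (Suc k) + real l)) = 0"
      proof
        fix k assume "k \<in> {..n} - {j}"
        then consider "k < j" | "k > j" by force
        then show "A_mat i k / fact k * (\<Sum>l\<le>n. A_mat j l / fact l / (real (Suc k) + real l)) = 0"
        proof cases
          case 1 then show ?thesis using vanish[OF that(2) 1] by simp
        next
          case 2 then show ?thesis using that by (simp add: A_mat_def)
        qed
      qed
    qed (use that in auto)
    also have "\<dots> = (if i = j then 1 / (2 * real j + 1) else 0)"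
    proof (cases "i = j")
      case True
      have "(\<Prod>m=1..j. real (Suc j) - real m) = (\<Prod>m=1..j. real m)"
        by (rule prod.reindex_bij_witness[of _ "\<lambda>m. Suc j - m" "\<lambda>m. Suc j - m"]) (auto simp: of_nat_diff)
      also have "\<dots> = fact j" by (simp add: fact_prod)
      finally have num: "(\<Prod>m=1..j. real (Suc j) - real m) = fact j" .
      have "(\<Prod>m\<le>j. real (Suc j) + real m) = (\<Prod>m=1..Suc j. real (j + m))"
        by (rule prod.reindex_bij_witness[of _ "\<lambda>m. m - 1" Suc]) auto
      also have "\<dots> = fact (j + Suc j) / fact j" by (rule prod_shift_fact)
      finally have den: "(\<Prod>m\<le>j. real (Suc j) + real m) = fact (j + Suc j) / fact j" .
      have "(\<Sum>l\<le>n. A_mat j l / fact l / (real (Suc j) + real l)) = fact j / (fact (j + Suc j) / fact j)"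
        unfolding moment[OF that(2)] num den ..
      moreover have "A_mat i j / fact j * (fact j / (fact (j + Suc j) / fact j)) = 1 / (2 * real j + 1)"
        using True by (simp add: A_mat_def)
      ultimately show ?thesis using True by simp
    qed (use that in \<open>auto simp: A_mat_def\<close>)
    finally show ?thesis .
  qed
  show ?thesis
  proof (cases "i \<le> j")
    case False
    have "(\<Sum>k\<le>n. \<Sum>l\<le>n. A_mat i k * A_mat j l / (real (k + l + 1) * fact k * fact l))
      = (\<Sum>l\<le>n. \<Sum>k\<le>n. A_mat j l * A_mat i k / (real (l + k + 1) * fact l * fact k))"
      by (subst sum.swap) (simp add: ac_simps)
    with *[of j i] False assms show ?thesis by simp
  qed (use * assms in auto)
qed

text \<open>
  A finite difference of order \<open>d\<close> of a binomial coefficient lowers its lower index by \<open>d\<close>.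
\<close>

lemma alternating_sum_choose_shift:
  "(\<Sum>m\<le>d. (-1)^m * real (d choose m) * real ((r + m) choose (d + l))) = (-1)^d * real (r choose l)"
proof (induction d arbitrary: l)
  case (Suc d)
  define c where "c = (\<lambda>m. real ((r + m) choose (Suc d + l)))"
  have pascal: "c (Suc m) = real ((r + m) choose (d + l)) + c m" for m
    by (simp add: c_def)
  have "(\<Sum>m\<le>Suc d. (-1)^m * real (Suc d choose m) * c m)
     = (\<Sum>m\<le>Suc d. (-1)^m * real (d choose m) * c m)
      - (\<Sum>m\<le>d. (-1)^m * real (d choose m) * c (Suc m))"
    unfolding sum.atMost_Suc_shift[of _ d]
    by (simp add: algebra_simps sum.distrib sum_negf sum_subtractf)
  also have "\<dots> = - (\<Sum>m\<le>d. (-1)^m * real (d choose m) * real ((r + m) choose (d + l)))"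
    by (simp add: pascal algebra_simps sum.distrib sum_subtractf sum_negf binomial_eq_0)
  finally show ?case by (simp add: Suc.IH c_def)
qed simp

text \<open>
  Multiplication by \<open>\<Gamma>\<close> re-expands the polynomial \<open>P\<^sub>j\<close> at the point 1, and
  \<open>P\<^sub>j(1 + y) = (-1)^j P\<^sub>j(- y)\<close>. In terms of coefficients this is a finite difference of order
  \<open>j - l\<close>.
\<close>

lemma A_mat_Gamma_mat:
  assumes "j \<le> n"
  shows "(\<Sum>k\<le>n. A_mat j k * Gamma_mat k l) = star_mat A_mat j l"
proof (cases "l \<le> j")
  case False
  then have "(\<Sum>k\<le>n. A_mat j k * Gamma_mat k l) = 0"
    by (intro sum.neutral) (auto simp: A_mat_def Gamma_mat_def)
  then show ?thesis using False by (simp add: star_mat_def A_mat_def)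
next
  case True
  define d where "d = j - l"
  have j: "j = l + d" using True by (simp add: d_def)
  have "(\<Sum>k\<le>n. A_mat j k * Gamma_mat k l) = (\<Sum>k=l..j. A_mat j k * Gamma_mat k l)"
    using assms by (intro sum.mono_neutral_right) (auto simp: A_mat_def Gamma_mat_def)
  also have "\<dots> = (\<Sum>m\<le>d. A_mat j (l + m) * Gamma_mat (l + m) l)"
    by (rule sum.reindex_bij_witness[of _ "\<lambda>m. l + m" "\<lambda>k. k - l"]) (auto simp: j)
  also have "\<dots> = (\<Sum>m\<le>d. (-1)^d * fact j / fact d * ((-1)^m * real (d choose m) * real ((j + l + m) choose (d + l))))"
  proof (intro sum.cong refl)
    fix m assume "m \<in> {..d}"
    then have m: "m \<le> d" by simp
    have c1: "real (d choose m) = fact d / (fact m * fact (d - m))" using m by (rule binomial_fact)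
    have c2: "real ((j + l + m) choose (d + l)) = fact (j + l + m) / (fact j * fact (l + m))"
      by (subst binomial_fact) (auto simp: j ac_simps)
    have "A_mat j (l + m) * Gamma_mat (l + m) l = (-1)^d * (-1)^m * fact (j + l + m) / (fact (l + m) * fact (d - m) * fact m)"
      using m by (simp add: A_mat_def Gamma_mat_def j power_add ac_simps flip: power_mult_distrib)
    also have "\<dots> = (-1)^d * fact j / fact d * ((-1)^m * real (d choose m) * real ((j + l + m) choose (d + l)))"
      unfolding c1 c2 by (simp add: field_simps)
    finally show "A_mat j (l + m) * Gamma_mat (l + m) l = (-1)^d * fact j / fact d * ((-1)^m * real (d choose m) * real ((j + l + m) choose (d + l)))" .
  qed
  also have "\<dots> = (-1)^d * fact j / fact d * ((-1)^d * real ((j + l) choose l))"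
    by (simp only: sum_distrib_left[symmetric] alternating_sum_choose_shift)
  also have "\<dots> = fact (j + l) / (fact l * fact d)"
    by (simp add: binomial_fact flip: power_mult_distrib)
  also have "\<dots> = star_mat A_mat j l"
    using True by (simp add: star_mat_def A_mat_def d_def flip: power_mult_distrib)
  finally show ?thesis .
qed

text \<open>
  The first product is the determinant of the matrix with rows \<open>sqrt (2 j + 1) A\<^sub>j\<close>, and the second
  factor is the constant of the standard normal density in \<open>n + 1\<close> dimensions.
\<close>

lemma K_const_eq:
  "K_const n = (\<Prod>j\<le>n. sqrt (2 * real j + 1) * A_mat j j) * (1 / sqrt (2 * pi)) ^ (n + 1)"
proof -
  have odd: "(\<Prod>j\<le>n. 2 * real j + 1) = fact (2 * n + 1) / (2 ^ n * fact n)"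
  proof (induction n)
    case (Suc n)
    have "fact (2 * Suc n + 1) = real (2 * n + 3) * (2 * real (Suc n)) * fact (2 * n + 1)"
      by (simp add: algebra_simps)
    moreover have "(\<Prod>j\<le>Suc n. 2 * real j + 1) = fact (2 * n + 1) / (2 ^ n * fact n) * real (2 * n + 3)"
      using Suc.IH by (simp add: algebra_simps)
    ultimately show ?case by (simp only: fact_Suc[of n] of_nat_mult power_Suc) (simp add: divide_simps del: of_nat_Suc fact_Suc)
  qed simp
  have "(\<Prod>j\<le>n. sqrt (2 * real j + 1)) = sqrt (\<Prod>j\<le>n. 2 * real j + 1)"
    by (induction n) (simp_all add: real_sqrt_mult)
  moreover have "(\<Prod>j\<le>n. A_mat j j) = (\<Prod>m=0..n. fact (2 * m) / fact m)"
    by (simp add: A_mat_def atMost_atLeast0 mult_2)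
  moreover have "(2 * pi) powr ((real n + 1) / 2) = sqrt (2 * pi) ^ (n + 1)"
  proof -
    have "(2 * pi) powr ((real n + 1) / 2) = ((2 * pi) powr (1 / 2)) powr real (n + 1)"
      by (simp add: powr_powr add.commute)
    also have "\<dots> = sqrt (2 * pi) ^ (n + 1)"
      by (subst powr_realpow) (auto simp: powr_half_sqrt)
    finally show ?thesis .
  qed
  ultimately show ?thesis
    unfolding K_const_def prod.distrib odd by (simp add: power_one_over field_simps)
qed

section \<open>Iterated integrals as limits of sums over increments\<close>

definition node :: "real \<Rightarrow> real \<Rightarrow> nat \<Rightarrow> nat \<Rightarrow> real" where
  "node a b N i = a + (b - a) * real i / real N"

lemma node_0 [simp]: "node a b N 0 = a"
  by (simp add: node_def)

lemma node_last [simp]: "0 < N \<Longrightarrow> node a b N N = b"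
  by (simp add: node_def)

lemma node_step: "node a b N (Suc i) - node a b N i = (b - a) / real N"
  by (simp add: node_def diff_divide_distrib[symmetric] algebra_simps)

lemma node_mono: "a \<le> b \<Longrightarrow> i \<le> j \<Longrightarrow> node a b N i \<le> node a b N j"
  by (simp add: node_def divide_right_mono mult_left_mono)

lemma node_in: "a \<le> b \<Longrightarrow> i \<le> N \<Longrightarrow> 0 < N \<Longrightarrow> node a b N i \<in> {a..b}"
  using node_mono[of a b 0 i N] node_mono[of a b i N N] by simp

text \<open>
  On a cell, \<open>f (\<xi>) * G - \<Phi>\<close> has derivative \<open>(f (\<xi>) - f) * g\<close>, where \<open>\<Phi>\<close> is an antiderivative of
  \<open>f * g\<close>. By uniform continuity of \<open>f\<close> this is uniformly small on fine partitions, so the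
  mean value inequality bounds the error of each cell by a small multiple of its length.
\<close>

lemma riemann_stieltjes_sum_tendsto:
  fixes f g G :: "real \<Rightarrow> real"
  assumes ab: "a \<le> b" and f: "continuous_on {a..b} f" and g: "continuous_on {a..b} g"
    and G: "\<And>x. x \<in> {a..b} \<Longrightarrow> (G has_real_derivative g x) (at x within {a..b})"
    and tags: "\<And>N i. i < N \<Longrightarrow> \<xi> N i \<in> {node a b N i..node a b N (Suc i)}"
  shows "(\<lambda>N. \<Sum>i<N. f (\<xi> N i) * (G (node a b N (Suc i)) - G (node a b N i)))
    \<longlonglongrightarrow> integral {a..b} (\<lambda>x. f x * g x)"
proof (rule LIMSEQ_I)
  fix e :: real assume e: "0 < e"
  define \<Phi> where "\<Phi> = (\<lambda>u. integral {a..u} (\<lambda>x. f x * g x))"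
  have \<Phi>: "(\<Phi> has_real_derivative f x * g x) (at x within {a..b})" if "x \<in> {a..b}" for x
    unfolding \<Phi>_def using that by (intro integral_has_real_derivative continuous_intros f g)
  have "bounded (g ` {a..b})"
    by (intro compact_imp_bounded compact_continuous_image g) simp
  then obtain C where C: "0 < C" "\<And>x. x \<in> {a..b} \<Longrightarrow> \<bar>g x\<bar> \<le> C"
    by (auto simp: bounded_pos)
  \<comment> \<open>The summand 1 keeps the denominator positive when \<open>a = b\<close>.\<close>
  define e' where "e' = e / (C * (b - a) + 1)"
  have pos: "0 < C * (b - a) + 1" using ab C by (simp add: add_nonneg_pos)
  have e': "0 < e'" unfolding e'_def using e pos by simp
  have e'_less: "e' * (C * (b - a)) < e"
    using e pos by (simp add: e'_def field_simps)
  have "uniformly_continuous_on {a..b} f"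
    using f by (intro compact_uniformly_continuous) auto
  with e' obtain d where d: "0 < d"
    and fd: "\<And>x y. x \<in> {a..b} \<Longrightarrow> y \<in> {a..b} \<Longrightarrow> \<bar>y - x\<bar> < d \<Longrightarrow> \<bar>f y - f x\<bar> < e'"
    unfolding uniformly_continuous_on_def by (metis dist_real_def)
  obtain N0 :: nat where N0: "(b - a) / d < real N0"
    using reals_Archimedean2 by blast
  show "\<exists>no. \<forall>N\<ge>no. norm ((\<Sum>i<N. f (\<xi> N i) * (G (node a b N (Suc i)) - G (node a b N i)))
    - integral {a..b} (\<lambda>x. f x * g x)) < e"
  proof (intro exI[of _ "Suc N0"] allI impI)
    fix N assume N: "Suc N0 \<le> N"
    define u where "u = node a b N"
    have N_pos: "0 < N" using N by simp
    have "(b - a) / d < real N" using N0 N by linarith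
    then have mesh: "(b - a) / real N < d"
      using d N_pos by (simp add: field_simps)
    have step: "\<bar>f (\<xi> N i) * (G (u (Suc i)) - G (u i)) - (\<Phi> (u (Suc i)) - \<Phi> (u i))\<bar> \<le> e' * C * ((b - a) / real N)"
      if i: "i < N" for i
    proof -
      let ?S = "{u i..u (Suc i)}"
      have le: "u i \<le> u (Suc i)" unfolding u_def by (intro node_mono ab) simp
      have sub: "?S \<subseteq> {a..b}"
        using node_in[OF ab _ N_pos, of i] node_in[OF ab _ N_pos, of "Suc i"] i by (auto simp: u_def)
      have tag: "\<xi> N i \<in> ?S" using tags[OF i] by (simp add: u_def)
      have len: "u (Suc i) - u i = (b - a) / real N" by (simp add: u_def node_step)
      have "norm ((f (\<xi> N i) * G (u (Suc i)) - \<Phi> (u (Suc i))) - (f (\<xi> N i) * G (u i) - \<Phi> (u i)))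
          \<le> (e' * C) * norm (u (Suc i) - u i)"
      proof (rule field_differentiable_bound[where S="?S" and f'="\<lambda>x. f (\<xi> N i) * g x - f x * g x"])
        fix x assume x: "x \<in> ?S"
        then have xab: "x \<in> {a..b}" using sub by blast
        show "((\<lambda>x. f (\<xi> N i) * G x - \<Phi> x) has_field_derivative f (\<xi> N i) * g x - f x * g x) (at x within ?S)"
          using DERIV_subset[OF G[OF xab] sub] DERIV_subset[OF \<Phi>[OF xab] sub]
          by (auto intro!: derivative_eq_intros)
        have "\<bar>\<xi> N i - x\<bar> < d" using x tag len mesh by auto
        then have "\<bar>f (\<xi> N i) - f x\<bar> < e'" using fd[of x "\<xi> N i"] tag sub xab by blast
        then have "\<bar>f (\<xi> N i) - f x\<bar> * \<bar>g x\<bar> \<le> e' * C"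
          using C(2)[OF xab] by (intro mult_mono) auto
        then show "norm (f (\<xi> N i) * g x - f x * g x) \<le> e' * C"
          by (simp add: abs_mult[symmetric] left_diff_distrib)
      qed (use le in auto)
      moreover have "norm (u (Suc i) - u i) = (b - a) / real N" using len ab by simp
      ultimately show ?thesis by (simp add: algebra_simps)
    qed
    have "integral {a..b} (\<lambda>x. f x * g x) = \<Phi> (u N) - \<Phi> (u 0)"
      using N_pos by (simp add: \<Phi>_def u_def)
    also have "\<dots> = (\<Sum>i<N. \<Phi> (u (Suc i)) - \<Phi> (u i))"
      by (simp add: sum_lessThan_telescope[where f="\<lambda>i. \<Phi> (u i)"])
    finally have "\<bar>(\<Sum>i<N. f (\<xi> N i) * (G (u (Suc i)) - G (u i))) - integral {a..b} (\<lambda>x. f x * g x)\<bar>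
        = \<bar>\<Sum>i<N. f (\<xi> N i) * (G (u (Suc i)) - G (u i)) - (\<Phi> (u (Suc i)) - \<Phi> (u i))\<bar>"
      by (simp add: sum_subtractf)
    also have "\<dots> \<le> (\<Sum>i<N. \<bar>f (\<xi> N i) * (G (u (Suc i)) - G (u i)) - (\<Phi> (u (Suc i)) - \<Phi> (u i))\<bar>)"
      by (rule sum_abs)
    also have "\<dots> \<le> (\<Sum>i<N. e' * C * ((b - a) / real N))"
      by (intro sum_mono step) simp
    also have "\<dots> = e' * (C * (b - a))" using N_pos by simp
    also have "\<dots> < e" by (rule e'_less)
    finally show "norm ((\<Sum>i<N. f (\<xi> N i) * (G (node a b N (Suc i)) - G (node a b N i)))
        - integral {a..b} (\<lambda>x. f x * g x)) < e"
      by (simp add: u_def)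
  qed
qed

lemma iter_int_continuous:
  assumes "continuous_on {0..} (\<lambda>t. B t \<omega>)"
  shows "continuous_on {0..b} (\<lambda>t. iter_int B k t \<omega>)"
proof (induction k)
  case 0
  show ?case using assms by (auto intro: continuous_on_subset)
next
  case (Suc k)
  then show ?case
    by (auto intro!: indefinite_integral_continuous_1 integrable_continuous_interval)
qed

lemma iter_int_has_derivative:
  assumes "continuous_on {0..} (\<lambda>t. B t \<omega>)" "t \<in> {0..b}"
  shows "((\<lambda>t. iter_int B (Suc k) t \<omega>) has_real_derivative iter_int B k t \<omega>) (at t within {0..b})"
  using integral_has_real_derivative[OF iter_int_continuous[of B \<omega> b k] assms(2)] assms(1) by simp

lemma abel_summation:
  fixes F G :: "nat \<Rightarrow> real"
  shows "(\<Sum>i<N. G i * (F (Suc i) - F i)) = G N * F N - G 0 * F 0 - (\<Sum>i<N. F (Suc i) * (G (Suc i) - G i))"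
  by (induction N) (simp_all add: algebra_simps)

text \<open>
  Summation by parts moves the differences from the path to the smooth integrand, which gives a
  Riemann-Stieltjes sum for \<open>\<integral>\<^sub>a\<^sup>b B(u) (b - u)^(k - 1) / (k - 1)! du\<close>. That integral is the remainder
  in Taylor's formula for the \<open>k\<close>-fold iterated integral. The convergence holds along each
  continuous path, not only in mean square.
\<close>

lemma iter_int_increment_limit:
  assumes cont: "continuous_on {0..} (\<lambda>t. B t \<omega>)" and a: "0 \<le> a" and ab: "a \<le> b"
  shows "(\<lambda>N. \<Sum>i<N. (b - node a b N i) ^ k / fact k * (B (node a b N (Suc i)) \<omega> - B (node a b N i) \<omega>))
    \<longlonglongrightarrow> iter_int B k b \<omega> - (\<Sum>j\<le>k. (b - a) ^ (k - j) / fact (k - j) * iter_int B j a \<omega>)"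
proof (cases k)
  case 0
  have "eventually (\<lambda>N. B b \<omega> - B a \<omega> = (\<Sum>i<N. B (node a b N (Suc i)) \<omega> - B (node a b N i) \<omega>)) sequentially"
    using eventually_gt_at_top[of 0]
    by eventually_elim (simp add: sum_lessThan_telescope[where f="\<lambda>i. B (node a b _ i) \<omega>"])
  from Lim_transform_eventually[OF tendsto_const this] show ?thesis
    by (simp add: 0)
next
  case (Suc m)
  define G where "G = (\<lambda>x::real. (b - x) ^ k / fact k)"
  define Df where "Df = (\<lambda>i t. iter_int B (k - i) t \<omega>)"
  have "((\<lambda>x. ((b - x) ^ (k - 1) / fact (k - 1)) *\<^sub>R Df k x) has_integral
     Df 0 b - (\<Sum>i<k. ((b - a) ^ i / fact i) *\<^sub>R Df i a)) {a..b}"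
  proof (rule Taylor_has_integral)
    fix i t assume i: "i < k" "a \<le> t" "t \<le> b"
    then have "((\<lambda>t. iter_int B (Suc (k - Suc i)) t \<omega>) has_real_derivative iter_int B (k - Suc i) t \<omega>) (at t within {0..b})"
      using a by (intro iter_int_has_derivative cont) auto
    then have "((\<lambda>t. iter_int B (Suc (k - Suc i)) t \<omega>) has_real_derivative iter_int B (k - Suc i) t \<omega>) (at t within {a..b})"
      by (rule DERIV_subset) (use a in auto)
    moreover have "Suc (k - Suc i) = k - i" using i by simp
    ultimately show "(Df i has_vector_derivative Df (Suc i) t) (at t within {a..b})"
      unfolding Df_def by (simp add: has_real_derivative_iff_has_vector_derivative del: iter_int.simps)
  qed (use Suc ab in auto)
  then have "((\<lambda>x. (b - x) ^ m / fact m * B x \<omega>) has_integral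
     iter_int B k b \<omega> - (\<Sum>i<k. (b - a) ^ i / fact i * iter_int B (k - i) a \<omega>)) {a..b}"
    by (simp add: Df_def Suc del: iter_int.simps(2))
  from integral_unique[OF has_integral_neg[OF this]]
  have int: "integral {a..b} (\<lambda>x. B x \<omega> * (- ((b - x) ^ m / fact m)))
      = - (iter_int B k b \<omega> - (\<Sum>i<k. (b - a) ^ i / fact i * iter_int B (k - i) a \<omega>))"
    by (simp add: mult.commute)
  have lim: "(\<lambda>N. \<Sum>i<N. B (node a b N (Suc i)) \<omega> * (G (node a b N (Suc i)) - G (node a b N i)))
    \<longlonglongrightarrow> integral {a..b} (\<lambda>x. B x \<omega> * (- ((b - x) ^ m / fact m)))"
  proof (rule riemann_stieltjes_sum_tendsto[where \<xi>="\<lambda>N i. node a b N (Suc i)", OF ab])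
    show "continuous_on {a..b} (\<lambda>x. B x \<omega>)"
      using cont by (rule continuous_on_subset) (use a in auto)
    show "continuous_on {a..b} (\<lambda>x. - ((b - x) ^ m / fact m))"
      by (intro continuous_intros) simp
    fix x :: real
    have "((\<lambda>x. (b - x) ^ Suc m) has_real_derivative - (real (Suc m) * (b - x) ^ m)) (at x within {a..b})"
      by (rule derivative_eq_intros refl | simp add: algebra_simps)+
    from DERIV_cdivide[OF this, of "fact k"]
    show "(G has_real_derivative - ((b - x) ^ m / fact m)) (at x within {a..b})"
      unfolding G_def Suc by (simp del: of_nat_Suc)
  qed (auto intro: node_mono ab)
  have "(\<lambda>N. G b * B b \<omega> - G a * B a \<omega>
       - (\<Sum>i<N. B (node a b N (Suc i)) \<omega> * (G (node a b N (Suc i)) - G (node a b N i))))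
    \<longlonglongrightarrow> G b * B b \<omega> - G a * B a \<omega>
       - (- (iter_int B k b \<omega> - (\<Sum>i<k. (b - a) ^ i / fact i * iter_int B (k - i) a \<omega>)))"
    by (intro tendsto_intros lim[unfolded int])
  moreover have "eventually (\<lambda>N. G b * B b \<omega> - G a * B a \<omega>
       - (\<Sum>i<N. B (node a b N (Suc i)) \<omega> * (G (node a b N (Suc i)) - G (node a b N i)))
     = (\<Sum>i<N. G (node a b N i) * (B (node a b N (Suc i)) \<omega> - B (node a b N i) \<omega>))) sequentially"
    using eventually_gt_at_top[of 0]
    by eventually_elim
      (simp add: abel_summation[where G="\<lambda>i. G (node a b _ i)" and F="\<lambda>i. B (node a b _ i) \<omega>"])
  ultimately have "(\<lambda>N. \<Sum>i<N. G (node a b N i) * (B (node a b N (Suc i)) \<omega> - B (node a b N i) \<omega>))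
    \<longlonglongrightarrow> G b * B b \<omega> - G a * B a \<omega>
       - (- (iter_int B k b \<omega> - (\<Sum>i<k. (b - a) ^ i / fact i * iter_int B (k - i) a \<omega>)))"
    by (rule Lim_transform_eventually)
  moreover have "(\<Sum>j\<le>k. (b - a) ^ (k - j) / fact (k - j) * iter_int B j a \<omega>)
      = G a * B a \<omega> + (\<Sum>i<k. (b - a) ^ i / fact i * iter_int B (k - i) a \<omega>)"
  proof -
    have "(\<Sum>j\<le>k. (b - a) ^ (k - j) / fact (k - j) * iter_int B j a \<omega>)
       = (\<Sum>i\<le>k. (b - a) ^ i / fact i * iter_int B (k - i) a \<omega>)"
      by (rule sum.reindex_bij_witness[of _ "\<lambda>i. k - i" "\<lambda>i. k - i"]) auto
    also have "\<dots> = (\<Sum>i<k. (b - a) ^ i / fact i * iter_int B (k - i) a \<omega>) + (b - a) ^ k / fact k * iter_int B (k - k) a \<omega>"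
      by (simp only: lessThan_Suc_atMost[symmetric] sum.lessThan_Suc)
    finally show ?thesis by (simp add: G_def del: iter_int.simps(2))
  qed
  moreover have "G b = 0" by (simp add: G_def Suc)
  ultimately show ?thesis unfolding G_def by (simp add: algebra_simps Suc del: iter_int.simps(2) power_Suc fact_Suc)
qed

section \<open>Uniqueness of multidimensional characteristic functions\<close>

lemma norm_iexp [simp]: "norm (iexp x) = 1"
  by (rule norm_exp_i_times)

lemma integrable_iexp_finite:
  assumes "finite_measure M" and [measurable]: "f \<in> borel_measurable M"
  shows "complex_integrable M (\<lambda>\<omega>. iexp (f \<omega>))"
  using assms(1) by (intro finite_measure.integrable_const_bound[of M _ 1]) auto

text \<open>
  Normalising both measures by their common total mass reduces this to probability measures.
\<close>

lemma finite_measure_char_unique: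
  fixes \<mu> \<nu> :: "real measure"
  assumes "finite_measure \<mu>" "finite_measure \<nu>" and sets: "sets \<mu> = sets borel" "sets \<nu> = sets borel"
    and eq: "\<And>t. (CLINT x|\<mu>. iexp (t * x)) = (CLINT x|\<nu>. iexp (t * x))"
  shows "\<mu> = \<nu>"
proof -
  interpret \<mu>: finite_measure \<mu> by fact
  interpret \<nu>: finite_measure \<nu> by fact
  have space: "space \<mu> = UNIV" "space \<nu> = UNIV"
    using sets_eq_imp_space_eq[OF sets(1)] sets_eq_imp_space_eq[OF sets(2)] by auto
  have mass: "measure \<mu> UNIV = measure \<nu> UNIV"
    using eq[of 0] space by simp
  define m where "m = measure \<mu> UNIV"
  show ?thesis
  proof (cases "m = 0")
    case True
    then have "emeasure \<mu> (space \<mu>) = 0" "emeasure \<nu> (space \<nu>) = 0"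
      using mass space by (auto simp: m_def \<mu>.emeasure_eq_measure \<nu>.emeasure_eq_measure)
    then have "emeasure \<mu> A = 0" "emeasure \<nu> A = 0" for A
      using emeasure_space[of \<mu> A] emeasure_space[of \<nu> A] by auto
    then show ?thesis by (intro measure_eqI) (auto simp: sets)
  next
    case False
    then have m: "0 < m" by (simp add: m_def zero_less_measure_iff)
    define normalise :: "real measure \<Rightarrow> real measure" where "normalise = (\<lambda>N. density N (\<lambda>_. ennreal (1 / m)))"
    have dist: "real_distribution (normalise N)"
      and char: "char (normalise N) t = (1 / m) *\<^sub>R (CLINT x|N. iexp (t * x))"
      if N: "finite_measure N" "sets N = sets borel" "measure N UNIV = m" for N :: "real measure" and t
    proof -
      interpret N: finite_measure N by fact
      have sp: "space N = UNIV" using sets_eq_imp_space_eq[OF N(2)] by auto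
      have [measurable]: "(\<lambda>x. iexp (t * x)) \<in> borel_measurable N"
        by (subst measurable_cong_sets[OF N(2) refl]) simp
      have "emeasure (normalise N) (space (normalise N)) = ennreal (1 / m) * ennreal m"
        unfolding normalise_def using sp N(3) sets.top[of N]
        by (simp add: emeasure_density_const N.emeasure_eq_measure)
      also have "\<dots> = 1" using m by (simp add: ennreal_mult[symmetric])
      finally have "prob_space (normalise N)" by (rule prob_spaceI)
      then show "real_distribution (normalise N)"
        by (simp add: real_distribution_def real_distribution_axioms_def normalise_def N(2) sp)
      show "char (normalise N) t = (1 / m) *\<^sub>R (CLINT x|N. iexp (t * x))"
        unfolding char_def normalise_def
        by (subst integral_density) (use m in \<open>auto simp del: of_real_mult\<close>)
    qed
    have eq': "normalise \<mu> = normalise \<nu>"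
      by (intro Levy_uniqueness ext)
        (auto simp: dist char assms m_def[symmetric] mass[symmetric] simp del: of_real_mult)
    show ?thesis
    proof (rule measure_eqI)
      fix A assume A: "A \<in> sets \<mu>"
      then have "ennreal (1 / m) * emeasure \<mu> A = ennreal (1 / m) * emeasure \<nu> A"
        using arg_cong[OF eq', of "\<lambda>N. emeasure N A"] sets
        by (simp add: normalise_def emeasure_density_const)
      then show "emeasure \<mu> A = emeasure \<nu> A"
        using m by (simp add: ennreal_mult_cancel_left)
    qed (simp add: sets)
  qed
qed

text \<open>
  This is uniqueness for the images under \<open>z\<close> and \<open>z'\<close> of the measures with densities \<open>h\<close> and
  \<open>h'\<close>.
\<close>

lemma weighted_char_unique:
  fixes z h :: "'a \<Rightarrow> real" and z' h' :: "'b \<Rightarrow> real"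
  assumes "finite_measure M" "finite_measure N"
    and [measurable]: "z \<in> borel_measurable M" "h \<in> borel_measurable M" "z' \<in> borel_measurable N" "h' \<in> borel_measurable N"
    and h: "\<And>\<omega>. 0 \<le> h \<omega>" "\<And>\<omega>. h \<omega> \<le> C" and h': "\<And>\<omega>. 0 \<le> h' \<omega>" "\<And>\<omega>. h' \<omega> \<le> C"
    and eq: "\<And>t. (CLINT \<omega>|M. h \<omega> *\<^sub>R iexp (t * z \<omega>)) = (CLINT \<omega>|N. h' \<omega> *\<^sub>R iexp (t * z' \<omega>))"
    and A[measurable]: "A \<in> sets borel"
  shows "(LINT \<omega>|M. h \<omega> * indicator A (z \<omega>)) = (LINT \<omega>|N. h' \<omega> * indicator A (z' \<omega>))"
proof -
  interpret M: finite_measure M by fact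
  interpret N: finite_measure N by fact
  have fin: "finite_measure (distr (density P (\<lambda>\<omega>. ennreal (g \<omega>))) borel y)"
    if "finite_measure P" and [measurable]: "y \<in> borel_measurable P" "g \<in> borel_measurable P"
      and g: "\<And>\<omega>. 0 \<le> g \<omega>" "\<And>\<omega>. g \<omega> \<le> C"
    for P :: "'c measure" and y g :: "'c \<Rightarrow> real"
  proof -
    interpret P: finite_measure P by fact
    have "integrable P g"
      using g by (intro P.integrable_const_bound[of _ C]) auto
    then have "(\<integral>\<^sup>+\<omega>. ennreal (g \<omega>) \<partial>P) < \<infinity>"
      using g by (simp add: integrable_iff_bounded)
    then have "finite_measure (density P (\<lambda>\<omega>. ennreal (g \<omega>)))"
      by (intro finite_measureI) (simp add: emeasure_density)
    then show ?thesis by (rule finite_measure.finite_measure_distr) simp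
  qed
  have *: "distr (density M h) borel z = distr (density N h') borel z'"
    by (intro finite_measure_char_unique fin assms)
      (auto simp: integral_distr integral_density h h' eq simp del: of_real_mult)
  have eq_A: "(LINT x|distr (density M h) borel z. indicator A x) = (LINT x|distr (density N h') borel z'. indicator A x :: real)"
    by (simp only: *)
  have pull: "(LINT x|distr (density P (\<lambda>\<omega>. ennreal (g \<omega>))) borel y. indicator A x) = (LINT \<omega>|P. g \<omega> * indicator A (y \<omega>))"
    if [measurable]: "y \<in> borel_measurable P" "g \<in> borel_measurable P" and g: "\<And>\<omega>. 0 \<le> g \<omega>"
    for P :: "'c measure" and y g :: "'c \<Rightarrow> real"
    using g by (subst integral_distr; (subst integral_density)?; simp)
  show ?thesis
    using eq_A unfolding pull[OF assms(3,4) h(1)] pull[OF assms(5,6) h'(1)] .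
qed

text \<open>
  The induction over coordinates needs that restricting to an event \<open>Z k \<in> A\<close> preserves equality of
  the characteristic functions of the other coordinates. For a fixed frequency \<open>\<theta>\<close> write \<open>S\<close> for the
  linear combination of these coordinates. The weights \<open>1 + cos S\<close> and \<open>1 + sin S\<close> are nonnegative, and
  the weighted characteristic functions of \<open>Z k\<close> are linear combinations of values of the joint
  characteristic function. One-dimensional uniqueness therefore gives the real and imaginary parts.
\<close>

lemma char_eq_restrict:
  fixes Z :: "'i \<Rightarrow> 'a \<Rightarrow> real" and Z' :: "'i \<Rightarrow> 'b \<Rightarrow> real"
  assumes M: "finite_measure M" and N: "finite_measure N" and I: "finite I" "k \<notin> I"
    and Z: "\<And>i. i \<in> insert k I \<Longrightarrow> Z i \<in> borel_measurable M"
    and Z': "\<And>i. i \<in> insert k I \<Longrightarrow> Z' i \<in> borel_measurable N"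
    and eq: "\<And>\<theta>. (CLINT \<omega>|M. iexp (\<Sum>i\<in>insert k I. \<theta> i * Z i \<omega>)) = (CLINT \<omega>|N. iexp (\<Sum>i\<in>insert k I. \<theta> i * Z' i \<omega>))"
    and A[measurable]: "A \<in> sets borel"
  shows "(CLINT \<omega>|M. indicator A (Z k \<omega>) *\<^sub>R iexp (\<Sum>i\<in>I. \<theta> i * Z i \<omega>))
    = (CLINT \<omega>|N. indicator A (Z' k \<omega>) *\<^sub>R iexp (\<Sum>i\<in>I. \<theta> i * Z' i \<omega>))"
proof -
  define S where "S = (\<lambda>\<omega>. \<Sum>i\<in>I. \<theta> i * Z i \<omega>)"
  define S' where "S' = (\<lambda>\<omega>. \<Sum>i\<in>I. \<theta> i * Z' i \<omega>)"
  have [measurable]: "Z k \<in> borel_measurable M" "S \<in> borel_measurable M" "Z' k \<in> borel_measurable N" "S' \<in> borel_measurable N"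
    unfolding S_def S'_def using Z Z' by auto
  have char: "(CLINT \<omega>|M. iexp (t * Z k \<omega> + r * S \<omega>)) = (CLINT \<omega>|N. iexp (t * Z' k \<omega> + r * S' \<omega>))" for t r
  proof -
    have e: "(\<Sum>i\<in>I. (if i = k then t else r * \<theta> i) * z i) = r * (\<Sum>i\<in>I. \<theta> i * z i)" for z :: "'i \<Rightarrow> real"
      unfolding sum_distrib_left using I by (intro sum.cong) auto
    show ?thesis
      using eq[of "\<lambda>i. if i = k then t else r * \<theta> i"] I
      by (simp add: e S_def S'_def)
  qed
  have plain: "(LINT \<omega>|M. indicator A (Z k \<omega>)) = (LINT \<omega>|N. indicator A (Z' k \<omega>) :: real)"
  proof -
    have "(LINT \<omega>|M. 1 * indicator A (Z k \<omega>)) = (LINT \<omega>|N. 1 * indicator A (Z' k \<omega>) :: real)"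
    proof (rule weighted_char_unique[OF M N, where C=1])
      show "(CLINT \<omega>|M. 1 *\<^sub>R iexp (t * Z k \<omega>)) = (CLINT \<omega>|N. 1 *\<^sub>R iexp (t * Z' k \<omega>))" for t
        using char[of t 0] by (simp only: scaleR_one mult_zero_left add_0_right)
    qed simp_all
    then show ?thesis by (simp only: mult_1)
  qed
  \<comment> \<open>The weight \<open>1 + Re (c * iexp s)\<close> is \<open>1 + cos s\<close> for \<open>c = 1\<close> and \<open>1 + sin s\<close> for \<open>c = - \<i>\<close>.\<close>
  have weight_split: "(1 + Re (c * iexp s)) *\<^sub>R iexp z
      = iexp z + (c / 2 * iexp (z + 1 * s) + cnj c / 2 * iexp (z + (-1) * s))" for c s z
  proof -
    have re: "complex_of_real (Re (c * e)) = (c * e + cnj c * cnj e) / 2" for e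
      using complex_add_cnj[of "c * e"] by (simp del: times_complex.sel)
    have "complex_of_real (1 + Re (c * e)) * X = X + (c / 2 * (X * e) + cnj c / 2 * (X * cnj e))" for e X
      unfolding of_real_add re by (simp add: field_simps)
    moreover have "iexp (z + 1 * s) = iexp z * iexp s"
      by (simp add: exp_add distrib_left)
    moreover have "iexp (z + (-1) * s) = iexp z * cnj (iexp s)"
      by (simp add: exp_cnj right_diff_distrib exp_diff exp_minus divide_inverse)
    ultimately show ?thesis
      by (simp only: scaleR_conv_of_real)
  qed
  have weighted: "(LINT \<omega>|M. Re (c * iexp (S \<omega>)) * indicator A (Z k \<omega>))
      = (LINT \<omega>|N. Re (c * iexp (S' \<omega>)) * indicator A (Z' k \<omega>))" if c: "norm c = 1" for c
  proof -
    have bound: "\<bar>Re (c * iexp s)\<bar> \<le> 1" for s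
      using abs_Re_le_cmod[of "c * iexp s"] c by (simp add: norm_mult)
    have bounds: "0 \<le> 1 + Re (c * iexp s)" "1 + Re (c * iexp s) \<le> 2" for s
      using bound[of s] by linarith+
    have int: "integrable P (\<lambda>\<omega>. Re (c * iexp (s \<omega>)) * indicator A (y \<omega>))" "integrable P (\<lambda>\<omega>. indicator A (y \<omega>) :: real)"
      "(CLINT \<omega>|P. (1 + Re (c * iexp (s \<omega>))) *\<^sub>R iexp (t * y \<omega>)) = 
        (CLINT \<omega>|P. iexp (t * y \<omega> + 0 * s \<omega>)) + (c / 2 * (CLINT \<omega>|P. iexp (t * y \<omega> + 1 * s \<omega>)) + cnj c / 2 * (CLINT \<omega>|P. iexp (t * y \<omega> + (-1) * s \<omega>)))"
      if P: "finite_measure P" and [measurable]: "s \<in> borel_measurable P" "y \<in> borel_measurable P"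
      for P :: "'c measure" and s y t
    proof -
      interpret P: finite_measure P by fact
      show "integrable P (\<lambda>\<omega>. Re (c * iexp (s \<omega>)) * indicator A (y \<omega>))"
        using bound by (intro P.integrable_const_bound[of _ 1]) (auto simp: abs_mult indicator_def)
      show "integrable P (\<lambda>\<omega>. indicator A (y \<omega>) :: real)"
        by (intro P.integrable_const_bound[of _ 1]) (auto simp: indicator_def)
      show "(CLINT \<omega>|P. (1 + Re (c * iexp (s \<omega>))) *\<^sub>R iexp (t * y \<omega>)) = 
        (CLINT \<omega>|P. iexp (t * y \<omega> + 0 * s \<omega>)) + (c / 2 * (CLINT \<omega>|P. iexp (t * y \<omega> + 1 * s \<omega>)) + cnj c / 2 * (CLINT \<omega>|P. iexp (t * y \<omega> + (-1) * s \<omega>)))"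
        unfolding weight_split
        by (simp only: mult_zero_left add_0_right) (subst Bochner_Integration.integral_add;
            (intro Bochner_Integration.integrable_add integrable_mult_right integrable_iexp_finite P; measurable)?;
            (subst Bochner_Integration.integral_add; (intro Bochner_Integration.integrable_add integrable_mult_right integrable_iexp_finite P; measurable)?;
            (simp only: integral_mult_right_zero)?)?)
    qed
    have eq_w: "(LINT \<omega>|M. (1 + Re (c * iexp (S \<omega>))) * indicator A (Z k \<omega>))
      = (LINT \<omega>|N. (1 + Re (c * iexp (S' \<omega>))) * indicator A (Z' k \<omega>))"
    proof (rule weighted_char_unique[OF M N, where C=2])
      show "(CLINT \<omega>|M. (1 + Re (c * iexp (S \<omega>))) *\<^sub>R iexp (t * Z k \<omega>))
          = (CLINT \<omega>|N. (1 + Re (c * iexp (S' \<omega>))) *\<^sub>R iexp (t * Z' k \<omega>))" for t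
        by (subst (1 2) int(3)) (simp_all only: M N char, measurable)
    qed (use bounds in simp_all)
    have split: "(LINT \<omega>|P. (1 + Re (c * iexp (s \<omega>))) * indicator A (y \<omega>))
        = (LINT \<omega>|P. indicator A (y \<omega>)) + (LINT \<omega>|P. Re (c * iexp (s \<omega>)) * indicator A (y \<omega>))"
      if "finite_measure P" "s \<in> borel_measurable P" "y \<in> borel_measurable P" for P :: "'c measure" and s y
      unfolding distrib_right mult_1 by (rule Bochner_Integration.integral_add[OF int(2,1)]) fact+
    show ?thesis
      using eq_w plain by (simp only: split[OF M \<open>S \<in> _\<close> \<open>Z k \<in> _\<close>] split[OF N \<open>S' \<in> _\<close> \<open>Z' k \<in> _\<close>] add_left_cancel)
  qed
  have int: "complex_integrable P (\<lambda>\<omega>. indicator A (y \<omega>) *\<^sub>R iexp (s \<omega>))"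
    if P: "finite_measure P" and [measurable]: "s \<in> borel_measurable P" "y \<in> borel_measurable P"
    for P :: "'c measure" and s y
    by (rule finite_measure.integrable_const_bound[OF P, of _ 1]) (auto simp: indicator_def)
  have Re: "(LINT \<omega>|M. Re (indicator A (Z k \<omega>) *\<^sub>R iexp (S \<omega>))) = (LINT \<omega>|N. Re (indicator A (Z' k \<omega>) *\<^sub>R iexp (S' \<omega>)))"
    using weighted[of 1] by (simp add: mult.commute)
  have Im: "(LINT \<omega>|M. Im (indicator A (Z k \<omega>) *\<^sub>R iexp (S \<omega>))) = (LINT \<omega>|N. Im (indicator A (Z' k \<omega>) *\<^sub>R iexp (S' \<omega>)))"
    using weighted[of "- \<i>"] by (simp add: mult.commute)
  show ?thesis
  proof -
    have "complex_integrable M (\<lambda>\<omega>. indicator A (Z k \<omega>) *\<^sub>R iexp (S \<omega>))"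
      "complex_integrable N (\<lambda>\<omega>. indicator A (Z' k \<omega>) *\<^sub>R iexp (S' \<omega>))"
      by (intro int M N; measurable)+
    from this[THEN integral_Re] this[THEN integral_Im] Re Im
    show ?thesis unfolding S_def S'_def by (simp only: complex_eq_iff)
  qed
qed

text \<open>
  Coordinates are removed one at a time by restricting both measures to the event that the removed
  coordinate lies in its side of the rectangle.
\<close>

theorem joint_char_unique_rectangles:
  fixes Z :: "'i \<Rightarrow> 'a \<Rightarrow> real" and Z' :: "'i \<Rightarrow> 'b \<Rightarrow> real"
  assumes "finite I" "finite_measure M" "finite_measure N"
    and "\<And>i. i \<in> I \<Longrightarrow> Z i \<in> borel_measurable M" "\<And>i. i \<in> I \<Longrightarrow> Z' i \<in> borel_measurable N"
    and "\<And>\<theta>. (CLINT \<omega>|M. iexp (\<Sum>i\<in>I. \<theta> i * Z i \<omega>)) = (CLINT \<omega>|N. iexp (\<Sum>i\<in>I. \<theta> i * Z' i \<omega>))"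
    and "\<And>i. i \<in> I \<Longrightarrow> A i \<in> sets borel"
  shows "measure M {\<omega>\<in>space M. \<forall>i\<in>I. Z i \<omega> \<in> A i} = measure N {\<omega>\<in>space N. \<forall>i\<in>I. Z' i \<omega> \<in> A i}"
  using assms
proof (induction I arbitrary: M N rule: finite_induct)
  case empty
  from empty(5)[of "\<lambda>_. 0"] show ?case by simp
next
  case (insert k I)
  note M = insert.prems(1) and N = insert.prems(2)
  have [measurable]: "A k \<in> sets borel" "Z k \<in> borel_measurable M" "Z' k \<in> borel_measurable N"
    using insert.prems by auto
  define M' where "M' = density M (\<lambda>\<omega>. ennreal (indicator (A k) (Z k \<omega>)))"
  define N' where "N' = density N (\<lambda>\<omega>. ennreal (indicator (A k) (Z' k \<omega>)))"
  have fin: "finite_measure (density P (\<lambda>\<omega>. ennreal (indicator (A k) (y \<omega>))))"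
    if P: "finite_measure P" and [measurable]: "y \<in> borel_measurable P" for P :: "'c measure" and y
  proof (rule finite_measureI)
    interpret P: finite_measure P by fact
    have "(\<integral>\<^sup>+\<omega>. ennreal (indicator (A k) (y \<omega>)) * indicator (space P) \<omega> \<partial>P) \<le> (\<integral>\<^sup>+\<omega>. 1 \<partial>P)"
      by (intro nn_integral_mono) (auto simp: indicator_def)
    also have "\<dots> < \<infinity>" using P.emeasure_finite[of "space P"] by (simp add: less_top[symmetric])
    finally show "emeasure (density P (\<lambda>\<omega>. ennreal (indicator (A k) (y \<omega>)))) (space (density P (\<lambda>\<omega>. ennreal (indicator (A k) (y \<omega>))))) \<noteq> \<infinity>"
      by (simp add: emeasure_density)
  qed
  have dens: "measure (density P (\<lambda>\<omega>. ennreal (indicator (A k) (Y k \<omega>)))) {\<omega>\<in>space P. \<forall>i\<in>I. Y i \<omega> \<in> A i}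
      = measure P {\<omega>\<in>space P. \<forall>i\<in>insert k I. Y i \<omega> \<in> A i}"
    if P: "finite_measure P" and Y: "\<And>i. i \<in> insert k I \<Longrightarrow> Y i \<in> borel_measurable P"
    for P :: "'c measure" and Y
  proof -
    have [measurable]: "Y k \<in> borel_measurable P" using Y by simp
    have [measurable]: "{\<omega>\<in>space P. \<forall>i\<in>I. Y i \<omega> \<in> A i} \<in> sets P"
      using insert.hyps(1) Y insert.prems(6)
      by (intro sets.sets_Collect_finite_All) (auto intro!: measurable_sets_Collect[where N=borel])
    have [measurable]: "{\<omega>\<in>space P. \<forall>i\<in>insert k I. Y i \<omega> \<in> A i} \<in> sets P"
      using insert.hyps(1) Y insert.prems(6)
      by (intro sets.sets_Collect_finite_All) (auto intro!: measurable_sets_Collect[where N=borel])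
    have "emeasure (density P (\<lambda>\<omega>. ennreal (indicator (A k) (Y k \<omega>)))) {\<omega>\<in>space P. \<forall>i\<in>I. Y i \<omega> \<in> A i}
      = (\<integral>\<^sup>+\<omega>. indicator {\<omega>\<in>space P. \<forall>i\<in>insert k I. Y i \<omega> \<in> A i} \<omega> \<partial>P)"
      unfolding nn_integral_indicator[symmetric]
      by (subst emeasure_density) (auto simp del: nn_integral_indicator intro!: nn_integral_cong split: split_indicator)
    then show ?thesis by (simp add: measure_def)
  qed
  have "measure M' {\<omega>\<in>space M'. \<forall>i\<in>I. Z i \<omega> \<in> A i} = measure N' {\<omega>\<in>space N'. \<forall>i\<in>I. Z' i \<omega> \<in> A i}"
  proof (rule insert.IH)
    fix \<theta>
    have [measurable]: "(\<lambda>\<omega>. \<Sum>i\<in>I. \<theta> i * Z i \<omega>) \<in> borel_measurable M" "(\<lambda>\<omega>. \<Sum>i\<in>I. \<theta> i * Z' i \<omega>) \<in> borel_measurable N"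
      using insert.prems by auto
    have restrict: "(CLINT \<omega>|density P (\<lambda>\<omega>. ennreal (indicator (A k) (y \<omega>))). iexp (s \<omega>)) = (CLINT \<omega>|P. indicator (A k) (y \<omega>) *\<^sub>R iexp (s \<omega>))"
      if [measurable]: "y \<in> borel_measurable P" "s \<in> borel_measurable P" for P :: "'c measure" and y s
      by (subst integral_density) simp_all
    show "(CLINT \<omega>|M'. iexp (\<Sum>i\<in>I. \<theta> i * Z i \<omega>)) = (CLINT \<omega>|N'. iexp (\<Sum>i\<in>I. \<theta> i * Z' i \<omega>))"
      using char_eq_restrict[OF M N insert.hyps insert.prems(3,4,5) \<open>A k \<in> sets borel\<close>, of \<theta>]
      unfolding M'_def N'_def by (subst (1 2) restrict) simp_all
  qed (use insert.prems in \<open>auto simp: M'_def N'_def intro!: fin\<close>)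
  then show ?case
    by (simp only: M'_def N'_def space_density dens[OF M, of Z, OF insert.prems(3)] dens[OF N, of Z', OF insert.prems(4)])
qed

theorem joint_char_unique:
  fixes Z :: "'i \<Rightarrow> 'a \<Rightarrow> real" and Z' :: "'i \<Rightarrow> 'b \<Rightarrow> real"
  assumes I: "finite I" and M: "finite_measure M" and N: "finite_measure N"
    and Z: "\<And>i. i \<in> I \<Longrightarrow> Z i \<in> borel_measurable M" and Z': "\<And>i. i \<in> I \<Longrightarrow> Z' i \<in> borel_measurable N"
    and eq: "\<And>\<theta>. (CLINT \<omega>|M. iexp (\<Sum>i\<in>I. \<theta> i * Z i \<omega>)) = (CLINT \<omega>|N. iexp (\<Sum>i\<in>I. \<theta> i * Z' i \<omega>))"
  shows "distr M (\<Pi>\<^sub>M i\<in>I. lborel) (\<lambda>\<omega>. \<lambda>i\<in>I. Z i \<omega>) = distr N (\<Pi>\<^sub>M i\<in>I. lborel) (\<lambda>\<omega>. \<lambda>i\<in>I. Z' i \<omega>)"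
proof (rule measure_eqI_PiM_finite[OF I, where A="\<lambda>_. space (\<Pi>\<^sub>M i\<in>I. lborel)"])
  interpret M: finite_measure M by fact
  interpret N: finite_measure N by fact
  let ?P = "\<Pi>\<^sub>M i\<in>I. lborel :: real measure"
  have meas: "(\<lambda>\<omega>. \<lambda>i\<in>I. Z i \<omega>) \<in> M \<rightarrow>\<^sub>M ?P" "(\<lambda>\<omega>. \<lambda>i\<in>I. Z' i \<omega>) \<in> N \<rightarrow>\<^sub>M ?P"
    using Z Z' by (auto intro!: measurable_restrict)
  show "emeasure (distr M ?P (\<lambda>\<omega>. \<lambda>i\<in>I. Z i \<omega>)) (Pi\<^sub>E I A) = emeasure (distr N ?P (\<lambda>\<omega>. \<lambda>i\<in>I. Z' i \<omega>)) (Pi\<^sub>E I A)"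
    if A: "\<And>i. i \<in> I \<Longrightarrow> A i \<in> sets lborel" for A
  proof -
    have "Pi\<^sub>E I A \<in> sets ?P" using I A by (rule sets_PiM_I_finite)
    moreover have "(\<lambda>\<omega>. \<lambda>i\<in>I. Z i \<omega>) -` Pi\<^sub>E I A \<inter> space M = {\<omega>\<in>space M. \<forall>i\<in>I. Z i \<omega> \<in> A i}"
      "(\<lambda>\<omega>. \<lambda>i\<in>I. Z' i \<omega>) -` Pi\<^sub>E I A \<inter> space N = {\<omega>\<in>space N. \<forall>i\<in>I. Z' i \<omega> \<in> A i}"
      by (auto simp: PiE_iff)
    moreover have "measure M {\<omega>\<in>space M. \<forall>i\<in>I. Z i \<omega> \<in> A i} = measure N {\<omega>\<in>space N. \<forall>i\<in>I. Z' i \<omega> \<in> A i}"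
      using A by (intro joint_char_unique_rectangles[OF I M N Z Z' eq]) auto
    ultimately show ?thesis
      using meas by (simp add: emeasure_distr M.emeasure_eq_measure N.emeasure_eq_measure)
  qed
  show "range (\<lambda>_. space ?P) \<subseteq> prod_algebra I (\<lambda>_. lborel)"
    using I by (auto intro!: prod_algebraI_finite simp: space_PiM)
  show "emeasure (distr M ?P (\<lambda>\<omega>. \<lambda>i\<in>I. Z i \<omega>)) (space ?P) \<noteq> \<infinity>"
    using meas by (simp add: emeasure_distr M.emeasure_eq_measure)
qed auto

lemma PiM_std_normal: "(\<Pi>\<^sub>M i\<in>I. std_normal_distribution)
    = density (\<Pi>\<^sub>M i\<in>I. lborel) (\<lambda>x. \<Prod>i\<in>I. ennreal (std_normal_density (x i)))" if I: "finite I"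
proof -
  interpret N: prob_space std_normal_distribution by (rule prob_space_normal_density) simp
  interpret N: product_sigma_finite "\<lambda>_. std_normal_distribution" ..
  interpret product_sigma_finite "\<lambda>_. lborel :: real measure" ..
  let ?P = "\<Pi>\<^sub>M i\<in>I. lborel :: real measure"
  have [measurable]: "(\<lambda>x. \<Prod>i\<in>I. ennreal (std_normal_density (x i))) \<in> borel_measurable ?P"
    by measurable
  show ?thesis
  proof (rule N.PiM_eqI[OF I, symmetric])
    show "sets (density ?P (\<lambda>x. \<Prod>i\<in>I. ennreal (std_normal_density (x i)))) = sets (\<Pi>\<^sub>M i\<in>I. std_normal_distribution)"
      by (simp cong: sets_PiM_cong)
    fix A :: "_ \<Rightarrow> real set" assume A: "\<And>i. i \<in> I \<Longrightarrow> A i \<in> sets std_normal_distribution"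
    have [measurable]: "Pi\<^sub>E I A \<in> sets ?P" using I A by (intro sets_PiM_I_finite) auto
    have "emeasure (density ?P (\<lambda>x. \<Prod>i\<in>I. ennreal (std_normal_density (x i)))) (Pi\<^sub>E I A)
      = (\<integral>\<^sup>+x. (\<Prod>i\<in>I. ennreal (std_normal_density (x i)) * indicator (A i) (x i)) \<partial>?P)"
    proof (subst emeasure_density)
      show "(\<integral>\<^sup>+x\<in>Pi\<^sub>E I A. (\<Prod>i\<in>I. ennreal (std_normal_density (x i))) \<partial>?P)
        = (\<integral>\<^sup>+x. (\<Prod>i\<in>I. ennreal (std_normal_density (x i)) * indicator (A i) (x i)) \<partial>?P)"
      proof (intro nn_integral_cong)
        fix x assume "x \<in> space ?P"
        then have "indicator (Pi\<^sub>E I A) x = (\<Prod>i\<in>I. indicator (A i) (x i) :: ennreal)"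
          using I by (auto simp: indicator_def space_PiM PiE_iff prod_zero_iff split: if_splits intro!: prod_zero[symmetric])
        then show "(\<Prod>i\<in>I. ennreal (std_normal_density (x i))) * indicator (Pi\<^sub>E I A) x
          = (\<Prod>i\<in>I. ennreal (std_normal_density (x i)) * indicator (A i) (x i))"
          by (simp add: prod.distrib)
      qed
    qed auto
    also have "\<dots> = (\<Prod>i\<in>I. \<integral>\<^sup>+x. ennreal (std_normal_density x) * indicator (A i) x \<partial>lborel)"
      using I A by (intro product_nn_integral_prod) auto
    also have "\<dots> = (\<Prod>i\<in>I. emeasure std_normal_distribution (A i))"
      using A by (intro prod.cong) (auto simp: emeasure_density)
    finally show "emeasure (density ?P (\<lambda>x. \<Prod>i\<in>I. ennreal (std_normal_density (x i)))) (Pi\<^sub>E I A)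
        = (\<Prod>i\<in>I. emeasure std_normal_distribution (A i))" .
  qed
qed

lemma distr_std_normal_of_char:
  fixes Y :: "'i \<Rightarrow> 'a \<Rightarrow> real"
  assumes I: "finite I" and M: "finite_measure M" and Y: "\<And>i. i \<in> I \<Longrightarrow> Y i \<in> borel_measurable M"
    and char: "\<And>\<theta>. (CLINT \<omega>|M. iexp (\<Sum>i\<in>I. \<theta> i * Y i \<omega>)) = of_real (exp (- (\<Sum>i\<in>I. (\<theta> i)\<^sup>2) / 2))"
  shows "distr M (\<Pi>\<^sub>M i\<in>I. lborel) (\<lambda>\<omega>. \<lambda>i\<in>I. Y i \<omega>)
    = density (\<Pi>\<^sub>M i\<in>I. lborel) (\<lambda>x. \<Prod>i\<in>I. ennreal (std_normal_density (x i)))"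
proof -
  interpret N: prob_space std_normal_distribution by (rule prob_space_normal_density) simp
  interpret P: product_prob_space "\<lambda>_. std_normal_distribution" I ..
  interpret P: finite_product_prob_space "\<lambda>_. std_normal_distribution" I
    by standard (rule I)
  let ?N = "\<Pi>\<^sub>M i\<in>I. std_normal_distribution"
  have component: "(\<lambda>x. x i) \<in> borel_measurable ?N" if "i \<in> I" for i
    using measurable_component_singleton[of i I "\<lambda>_. std_normal_distribution"] that by simp
  have "distr M (\<Pi>\<^sub>M i\<in>I. lborel) (\<lambda>\<omega>. \<lambda>i\<in>I. Y i \<omega>) = distr ?N (\<Pi>\<^sub>M i\<in>I. lborel) (\<lambda>x. \<lambda>i\<in>I. x i)"
  proof (rule joint_char_unique[OF I M _ Y component])
    fix \<theta> :: "'i \<Rightarrow> real"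
    have "(CLINT x|?N. iexp (\<Sum>i\<in>I. \<theta> i * x i)) = (CLINT x|?N. (\<Prod>i\<in>I. iexp (\<theta> i * x i)))"
      using I by (simp add: exp_sum[symmetric] sum_distrib_left)
    also have "\<dots> = (\<Prod>i\<in>I. CLINT x|std_normal_distribution. iexp (\<theta> i * x))"
      by (intro P.product_integral_prod I integrable_iexp_finite) (auto intro: N.finite_measure_axioms)
    also have "\<dots> = (\<Prod>i\<in>I. of_real (exp (- (\<theta> i)\<^sup>2 / 2)))"
      by (intro prod.cong refl) (simp only: char_def[symmetric] char_std_normal_distribution)
    also have "\<dots> = of_real (exp (- (\<Sum>i\<in>I. (\<theta> i)\<^sup>2) / 2))"
      using I by (simp only: of_real_prod[symmetric] exp_sum[symmetric] sum_negf[symmetric] sum_divide_distrib)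
    finally show "(CLINT \<omega>|M. iexp (\<Sum>i\<in>I. \<theta> i * Y i \<omega>)) = (CLINT x|?N. iexp (\<Sum>i\<in>I. \<theta> i * x i))"
      using char by simp
  qed (rule P.finite_measure_axioms)
  also have "\<dots> = distr ?N ?N (\<lambda>x. x)"
    by (intro distr_cong refl) (auto simp: space_PiM PiE_iff extensional_def fun_eq_iff cong: sets_PiM_cong)
  also have "\<dots> = density (\<Pi>\<^sub>M i\<in>I. lborel) (\<lambda>x. \<Prod>i\<in>I. ennreal (std_normal_density (x i)))"
    using PiM_std_normal[OF I] by (simp add: distr_id2)
  finally show ?thesis .
qed

text \<open>
  Independence of two random vectors: the joint vector has the same characteristic function as the
  vector formed from two independent copies, realised on the product of the probability space with
  itself. The sum type indexes the coordinates of both vectors.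
\<close>

lemma distr_pair_of_char:
  fixes U :: "'i \<Rightarrow> 'a \<Rightarrow> real" and V :: "'j \<Rightarrow> 'a \<Rightarrow> real"
  assumes I: "finite I" and J: "finite J" and M: "prob_space M"
    and U: "\<And>i. i \<in> I \<Longrightarrow> U i \<in> borel_measurable M" and V: "\<And>j. j \<in> J \<Longrightarrow> V j \<in> borel_measurable M"
    and char: "\<And>c d. (CLINT \<omega>|M. iexp ((\<Sum>i\<in>I. c i * U i \<omega>) + (\<Sum>j\<in>J. d j * V j \<omega>)))
      = (CLINT \<omega>|M. iexp (\<Sum>i\<in>I. c i * U i \<omega>)) * (CLINT \<omega>|M. iexp (\<Sum>j\<in>J. d j * V j \<omega>))"
  defines "P \<equiv> \<Pi>\<^sub>M i\<in>I. lborel" and "Q \<equiv> \<Pi>\<^sub>M j\<in>J. lborel"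
  shows "distr M (P \<Otimes>\<^sub>M Q) (\<lambda>\<omega>. (\<lambda>i\<in>I. U i \<omega>, \<lambda>j\<in>J. V j \<omega>))
    = distr M P (\<lambda>\<omega>. \<lambda>i\<in>I. U i \<omega>) \<Otimes>\<^sub>M distr M Q (\<lambda>\<omega>. \<lambda>j\<in>J. V j \<omega>)"
proof -
  interpret M: prob_space M by fact
  interpret MM: pair_prob_space M M ..
  let ?S = "I <+> J"
  let ?R = "\<Pi>\<^sub>M k\<in>?S. lborel :: real measure"
  define split where "split = (\<lambda>x :: 'i + 'j \<Rightarrow> real. (\<lambda>i\<in>I. x (Inl i), \<lambda>j\<in>J. x (Inr j)))"
  define Z where "Z = case_sum U V"
  define Z' where "Z' = case_sum (\<lambda>i. U i \<circ> fst) (\<lambda>j. V j \<circ> snd)"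
  have S: "finite ?S" using I J by simp
  have sum_S: "(\<Sum>k\<in>?S. f k) = (\<Sum>i\<in>I. f (Inl i)) + (\<Sum>j\<in>J. f (Inr j))" for f :: "'i + 'j \<Rightarrow> real"
    using I J by (simp add: sum.Plus)
  have Z: "Z k \<in> borel_measurable M" if "k \<in> ?S" for k
    using that U V by (auto simp: Z_def)
  have Z': "Z' k \<in> borel_measurable (M \<Otimes>\<^sub>M M)" if "k \<in> ?S" for k
    using that U V by (auto simp: Z'_def intro!: measurable_comp[where N=M])
  have Umeas: "(\<lambda>\<omega>. \<lambda>i\<in>I. U i \<omega>) \<in> M \<rightarrow>\<^sub>M P" and Vmeas: "(\<lambda>\<omega>. \<lambda>j\<in>J. V j \<omega>) \<in> M \<rightarrow>\<^sub>M Q"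
    unfolding P_def Q_def using U V by (auto intro!: measurable_restrict)
  have split: "split \<in> ?R \<rightarrow>\<^sub>M P \<Otimes>\<^sub>M Q"
    unfolding split_def P_def Q_def
    by (intro measurable_Pair measurable_restrict measurable_component_singleton) auto
  have law: "distr M ?R (\<lambda>\<omega>. \<lambda>k\<in>?S. Z k \<omega>) = distr (M \<Otimes>\<^sub>M M) ?R (\<lambda>\<omega>. \<lambda>k\<in>?S. Z' k \<omega>)"
  proof (rule joint_char_unique[OF S M.finite_measure_axioms MM.finite_measure_axioms Z Z'])
    fix \<theta> :: "'i + 'j \<Rightarrow> real"
    let ?u = "\<lambda>\<omega>. iexp (\<Sum>i\<in>I. \<theta> (Inl i) * U i \<omega>)" and ?v = "\<lambda>\<omega>. iexp (\<Sum>j\<in>J. \<theta> (Inr j) * V j \<omega>)"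
    have [measurable]: "(\<lambda>\<omega>. \<Sum>i\<in>I. \<theta> (Inl i) * U i \<omega>) \<in> borel_measurable M" "(\<lambda>\<omega>. \<Sum>j\<in>J. \<theta> (Inr j) * V j \<omega>) \<in> borel_measurable M"
      using U V by auto
    have "(CLINT p|(M \<Otimes>\<^sub>M M). iexp (\<Sum>k\<in>?S. \<theta> k * Z' k p)) = (CLINT p|(M \<Otimes>\<^sub>M M). ?u (fst p) * ?v (snd p))"
      unfolding sum_S by (simp add: Z'_def distrib_left exp_add)
    also have "\<dots> = (CLINT \<omega>|M. CLINT \<omega>'|M. ?u \<omega> * ?v \<omega>')"
      by (subst MM.integral_fst'[symmetric])
        (auto intro!: MM.integrable_const_bound[where B=1] simp: norm_mult simp del: of_real_sum)
    also have "\<dots> = (CLINT \<omega>|M. ?u \<omega>) * (CLINT \<omega>|M. ?v \<omega>)"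
      by simp
    also have "\<dots> = (CLINT \<omega>|M. iexp (\<Sum>k\<in>?S. \<theta> k * Z k \<omega>))"
      unfolding sum_S char[symmetric] by (simp add: Z_def)
    finally show "(CLINT \<omega>|M. iexp (\<Sum>k\<in>?S. \<theta> k * Z k \<omega>)) = (CLINT p|(M \<Otimes>\<^sub>M M). iexp (\<Sum>k\<in>?S. \<theta> k * Z' k p))" ..
  qed
  have Zmeas: "(\<lambda>\<omega>. \<lambda>k\<in>?S. Z k \<omega>) \<in> M \<rightarrow>\<^sub>M ?R" "(\<lambda>\<omega>. \<lambda>k\<in>?S. Z' k \<omega>) \<in> M \<Otimes>\<^sub>M M \<rightarrow>\<^sub>M ?R"
    using Z Z' by (auto intro!: measurable_restrict)
  have "distr M (P \<Otimes>\<^sub>M Q) (\<lambda>\<omega>. (\<lambda>i\<in>I. U i \<omega>, \<lambda>j\<in>J. V j \<omega>)) = distr (distr M ?R (\<lambda>\<omega>. \<lambda>k\<in>?S. Z k \<omega>)) (P \<Otimes>\<^sub>M Q) split"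
    by (subst distr_distr[OF split Zmeas(1)]) (auto intro!: distr_cong simp: split_def Z_def restrict_def fun_eq_iff)
  also have "\<dots> = distr (M \<Otimes>\<^sub>M M) (P \<Otimes>\<^sub>M Q) (\<lambda>(\<omega>, \<omega>'). (\<lambda>i\<in>I. U i \<omega>, \<lambda>j\<in>J. V j \<omega>'))"
    unfolding law
    by (subst distr_distr[OF split Zmeas(2)]) (auto intro!: distr_cong simp: split_def Z'_def restrict_def fun_eq_iff)
  also have "\<dots> = distr M P (\<lambda>\<omega>. \<lambda>i\<in>I. U i \<omega>) \<Otimes>\<^sub>M distr M Q (\<lambda>\<omega>. \<lambda>j\<in>J. V j \<omega>)"
    by (rule pair_measure_distr[symmetric, OF Umeas Vmeas])
      (intro prob_space_imp_sigma_finite M.prob_space_distr Vmeas)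
  finally show ?thesis .
qed

section \<open>The joint characteristic function of a state and the next innovation\<close>

text \<open>
  The quadratic form of the covariance matrix of \<open>W(t)\<close>, that is, the variance of
  \<open>\<Sum>k\<le>n. c k * W\<^sub>k(t)\<close>.
\<close>

definition cov_form :: "nat \<Rightarrow> real \<Rightarrow> (nat \<Rightarrow> real) \<Rightarrow> real" where
  "cov_form n t c = (\<Sum>j\<le>n. \<Sum>k\<le>n. c j * c k * (t ^ (j + k + 1) / (real (j + k + 1) * fact j * fact k)))"

lemma cov_form_zero: "cov_form n t (\<lambda>_. 0) = 0"
  by (simp add: cov_form_def)

text \<open>
  The part of \<open>W\<^sub>k(b)\<close> that is not predicted by Taylor's formula from the state at time \<open>a\<close>.
\<close>

definition innovation :: "(real \<Rightarrow> 'a \<Rightarrow> real) \<Rightarrow> real \<Rightarrow> real \<Rightarrow> nat \<Rightarrow> 'a \<Rightarrow> real" where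
  "innovation B a b k \<omega> = iter_int B k b \<omega> - (\<Sum>j\<le>k. (b - a) ^ (k - j) / fact (k - j) * iter_int B j a \<omega>)"

text \<open>
  The approximation of the Wiener integral of the polynomial \<open>\<Sum>k\<le>n. c k * (b - u)^k / k!\<close> over
  \<open>[a, b]\<close> on a partition into \<open>N\<close> equal cells, with the integrand evaluated at left end points.
\<close>

definition wiener_sum :: "(real \<Rightarrow> 'a \<Rightarrow> real) \<Rightarrow> nat \<Rightarrow> (nat \<Rightarrow> real) \<Rightarrow> real \<Rightarrow> real \<Rightarrow> nat \<Rightarrow> 'a \<Rightarrow> real" where
  "wiener_sum B n c a b N \<omega> = (\<Sum>i<N. (\<Sum>k\<le>n. c k * ((b - node a b N i) ^ k / fact k))
     * (B (node a b N (Suc i)) \<omega> - B (node a b N i) \<omega>))"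

lemma wiener_sum_tendsto:
  assumes "continuous_on {0..} (\<lambda>t. B t \<omega>)" "0 \<le> a" "a \<le> b"
  shows "(\<lambda>N. wiener_sum B n c a b N \<omega>) \<longlonglongrightarrow> (\<Sum>k\<le>n. c k * innovation B a b k \<omega>)"
proof -
  have "wiener_sum B n c a b N \<omega> = (\<Sum>k\<le>n. c k * (\<Sum>i<N. (b - node a b N i) ^ k / fact k
      * (B (node a b N (Suc i)) \<omega> - B (node a b N i) \<omega>)))" for N
    unfolding wiener_sum_def sum_distrib_left sum_distrib_right
    by (subst sum.swap) (simp add: mult.assoc)
  then show ?thesis
    unfolding innovation_def using assms by (simp only:) (intro tendsto_intros iter_int_increment_limit)
qed

text \<open>
  The variances of the approximating sums are themselves Riemann sums for the integral of the squared
  integrand (the Ito isometry).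
\<close>

lemma wiener_variance_tendsto:
  assumes ab: "a \<le> b"
  shows "(\<lambda>N. \<Sum>i<N. (\<Sum>k\<le>n. c k * ((b - node a b N i) ^ k / fact k))\<^sup>2 * (node a b N (Suc i) - node a b N i))
    \<longlonglongrightarrow> cov_form n (b - a) c"
proof -
  let ?f = "\<lambda>x. (\<Sum>k\<le>n. c k * ((b - x) ^ k / fact k))\<^sup>2"
  have "(\<lambda>N. \<Sum>i<N. ?f (node a b N i) * ((\<lambda>x. x) (node a b N (Suc i)) - (\<lambda>x. x) (node a b N i)))
    \<longlonglongrightarrow> integral {a..b} (\<lambda>x. ?f x * 1)"
    by (rule riemann_stieltjes_sum_tendsto[OF ab])
      (auto intro!: continuous_intros derivative_eq_intros node_mono ab)
  moreover have "((\<lambda>x. ?f x) has_integral cov_form n (b - a) c) {a..b}"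
  proof -
    have power: "((\<lambda>x. (b - x) ^ m) has_integral (b - a) ^ (m + 1) / real (m + 1)) {a..b}" for m
    proof -
      have "((\<lambda>x. - ((b - x) ^ (m + 1)) / real (m + 1)) has_vector_derivative (b - x) ^ m) (at x within {a..b})" for x
      proof -
        have "((\<lambda>x. - ((b - x) ^ (m + 1))) has_real_derivative real (m + 1) * (b - x) ^ m) (at x within {a..b})"
          by (rule derivative_eq_intros refl | simp add: algebra_simps)+
        from DERIV_cdivide[OF this, of "real (m + 1)"] show ?thesis
          by (simp add: has_real_derivative_iff_has_vector_derivative del: of_nat_Suc of_nat_add)
      qed
      from fundamental_theorem_of_calculus[OF ab this] show ?thesis by simp
    qed
    have "((\<lambda>x. \<Sum>j\<le>n. \<Sum>k\<le>n. c j * c k / (fact j * fact k) * (b - x) ^ (j + k))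
       has_integral (\<Sum>j\<le>n. \<Sum>k\<le>n. c j * c k / (fact j * fact k) * ((b - a) ^ (j + k + 1) / real (j + k + 1)))) {a..b}"
      by (intro has_integral_sum has_integral_mult_right power) auto
    moreover have "(\<Sum>j\<le>n. \<Sum>k\<le>n. c j * c k / (fact j * fact k) * (b - x) ^ (j + k)) = ?f x" for x
      by (simp add: power2_eq_square sum_product power_add mult_ac)
    moreover have "(\<Sum>j\<le>n. \<Sum>k\<le>n. c j * c k / (fact j * fact k) * ((b - a) ^ (j + k + 1) / real (j + k + 1))) = cov_form n (b - a) c"
      unfolding cov_form_def by (intro sum.cong refl) (simp add: mult_ac)
    ultimately show ?thesis by simp
  qed
  ultimately show ?thesis by (simp add: integral_unique)
qed

lemma sum_lessThan_add:
  fixes f :: "nat \<Rightarrow> 'b::comm_monoid_add"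
  shows "(\<Sum>i<m + k. f i) = (\<Sum>i<m. f i) + (\<Sum>i<k. f (m + i))"
  by (induction k) (simp_all add: add.assoc)

context standard_brownian_motion
begin

lemma char_increment:
  assumes "0 \<le> s" "s \<le> t"
  shows "(CLINT \<omega>|M. iexp (g * (B t \<omega> - B s \<omega>))) = of_real (exp (- (g\<^sup>2 * (t - s)) / 2))"
proof (cases "s = t")
  case True
  then show ?thesis by (simp add: prob_space)
next
  case False
  then have st: "s < t" using assms by simp
  define \<sigma> where "\<sigma> = sqrt (t - s)"
  have \<sigma>: "0 < \<sigma>" "\<sigma>\<^sup>2 = t - s" using st by (auto simp: \<sigma>_def)
  have "distributed M lborel (\<lambda>\<omega>. (B t \<omega> - B s \<omega> - 0) / \<sigma>) std_normal_density"
    using normal_increments[OF assms(1) st] normal_standard_normal_convert[OF \<sigma>(1)] by (simp add: \<sigma>_def)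
  then have law: "distr M lborel (\<lambda>\<omega>. (B t \<omega> - B s \<omega>) / \<sigma>) = std_normal_distribution"
    and [measurable]: "(\<lambda>\<omega>. (B t \<omega> - B s \<omega>) / \<sigma>) \<in> borel_measurable M"
    by (auto simp: distributed_def)
  have "(CLINT \<omega>|M. iexp (g * (B t \<omega> - B s \<omega>))) = (CLINT \<omega>|M. iexp ((g * \<sigma>) * ((B t \<omega> - B s \<omega>) / \<sigma>)))"
    using \<sigma> by simp
  also have "\<dots> = (CLINT x|distr M lborel (\<lambda>\<omega>. (B t \<omega> - B s \<omega>) / \<sigma>). iexp ((g * \<sigma>) * x))"
    by (rule integral_distr[symmetric]) simp_all
  also have "\<dots> = of_real (exp (- (g * \<sigma>)\<^sup>2 / 2))"
    unfolding law char_def[symmetric] char_std_normal_distribution ..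
  finally show ?thesis by (simp only: power_mult_distrib \<sigma>(2))
qed

lemma char_increment_sum:
  assumes \<tau>: "0 \<le> \<tau> 0" "\<And>i. i < m \<Longrightarrow> \<tau> i \<le> \<tau> (Suc i)"
  shows "(CLINT \<omega>|M. iexp (\<Sum>i<m. g i * (B (\<tau> (Suc i)) \<omega> - B (\<tau> i) \<omega>)))
    = of_real (exp (- (\<Sum>i<m. (g i)\<^sup>2 * (\<tau> (Suc i) - \<tau> i)) / 2))"
proof -
  have nonneg: "0 \<le> \<tau> i" if "i \<le> m" for i
    using that by (induction i) (use \<tau> in \<open>auto intro: order_trans[OF _ \<tau>(2)]\<close>)
  have rv: "random_variable borel (\<lambda>\<omega>. g i * (B (\<tau> (Suc i)) \<omega> - B (\<tau> i) \<omega>))" if "i < m" for i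
    using random_variable_B[OF nonneg, of i] random_variable_B[OF nonneg, of "Suc i"] that by auto
  have "indep_vars (\<lambda>_. borel) (\<lambda>i \<omega>. g i * (B (\<tau> (Suc i)) \<omega> - B (\<tau> i) \<omega>)) {..<m}"
    by (rule indep_vars_compose2[OF independent_increments[OF \<tau>], where Y="\<lambda>i x. g i * x"]) auto
  from char_distr_sum[OF this, of 1]
  have "(CLINT \<omega>|M. iexp (\<Sum>i<m. g i * (B (\<tau> (Suc i)) \<omega> - B (\<tau> i) \<omega>)))
    = (\<Prod>i<m. CLINT \<omega>|M. iexp (g i * (B (\<tau> (Suc i)) \<omega> - B (\<tau> i) \<omega>)))"
    unfolding char_def using rv by (simp add: integral_distr borel_measurable_sum del: of_real_sum of_real_mult of_real_diff)
  also have "\<dots> = (\<Prod>i<m. of_real (exp (- ((g i)\<^sup>2 * (\<tau> (Suc i) - \<tau> i)) / 2)))"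
    using nonneg \<tau>(2) by (intro prod.cong refl char_increment) auto
  also have "\<dots> = of_real (exp (- (\<Sum>i<m. (g i)\<^sup>2 * (\<tau> (Suc i) - \<tau> i)) / 2))"
    by (simp only: of_real_prod[symmetric] exp_sum[OF finite_lessThan, symmetric] sum_negf[symmetric] sum_divide_distrib)
  finally show ?thesis .
qed

lemma wiener_sum_measurable:
  assumes "0 \<le> a" "a \<le> b"
  shows "random_variable borel (wiener_sum B n c a b N)"
proof -
  have "random_variable borel (B (node a b N i))" for i
    using node_mono[of a b 0 i N] assms by (intro random_variable_B) auto
  note [measurable] = this
  show ?thesis unfolding wiener_sum_def by measurable
qed

text \<open>
  Both sums together form one sum over the increments of \<open>B\<close> along the concatenated partition \<open>\<tau>\<close> of
  \<open>[0, s + t]\<close>, so independence of the increments applies.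
\<close>

lemma char_wiener_sums:
  assumes "0 \<le> s" "0 \<le> t"
  shows "(CLINT \<omega>|M. iexp (wiener_sum B n c 0 s N \<omega> + wiener_sum B n d s (s + t) N \<omega>))
    = of_real (exp (- ((\<Sum>i<N. (\<Sum>k\<le>n. c k * ((s - node 0 s N i) ^ k / fact k))\<^sup>2 * (node 0 s N (Suc i) - node 0 s N i))
       + (\<Sum>i<N. (\<Sum>k\<le>n. d k * ((s + t - node s (s + t) N i) ^ k / fact k))\<^sup>2 * (node s (s + t) N (Suc i) - node s (s + t) N i))) / 2))"
proof -
  define \<tau> where "\<tau> = (\<lambda>i. if i < N then node 0 s N i else node s (s + t) N (i - N))"
  define g where "g = (\<lambda>i. if i < N then (\<Sum>k\<le>n. c k * ((s - node 0 s N i) ^ k / fact k))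
     else (\<Sum>k\<le>n. d k * ((s + t - node s (s + t) N (i - N)) ^ k / fact k)))"
  have \<tau>_left: "\<tau> i = node 0 s N i" "\<tau> (Suc i) = node 0 s N (Suc i)" if "i < N" for i
    using that by (cases "Suc i = N"; auto simp: \<tau>_def node_def)+
  have \<tau>_right: "\<tau> (N + i) = node s (s + t) N i" for i
    by (simp add: \<tau>_def)
  \<comment> \<open>Used below for the linear form in the increments and for its variance.\<close>
  have split: "(\<Sum>i<N + N. f (g i) (\<tau> (Suc i)) (\<tau> i))
     = (\<Sum>i<N. f (\<Sum>k\<le>n. c k * ((s - node 0 s N i) ^ k / fact k)) (node 0 s N (Suc i)) (node 0 s N i))
     + (\<Sum>i<N. f (\<Sum>k\<le>n. d k * ((s + t - node s (s + t) N i) ^ k / fact k)) (node s (s + t) N (Suc i)) (node s (s + t) N i))"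
    for f :: "real \<Rightarrow> real \<Rightarrow> real \<Rightarrow> real"
    unfolding sum_lessThan_add
    by (intro arg_cong2[where f="(+)"] sum.cong refl)
      (simp_all add: \<tau>_left \<tau>_right add_Suc_right[symmetric] g_def del: add_Suc_right)
  have mono: "\<tau> i \<le> \<tau> (Suc i)" if "i < N + N" for i
  proof (cases "i < N")
    case True
    then show ?thesis using assms by (simp add: \<tau>_left node_mono)
  next
    case False
    then obtain l where "i = N + l" using le_Suc_ex not_less by blast
    then show ?thesis
      using assms by (simp add: \<tau>_right add_Suc_right[symmetric] node_mono del: add_Suc_right)
  qed
  have "0 \<le> \<tau> 0" using assms by (simp add: \<tau>_def)
  from char_increment_sum[OF this mono, where m="N + N" and g=g] show ?thesis
    by (simp only: split[of "\<lambda>g u v. g * (B u _ - B v _)"] split[of "\<lambda>g u v. g\<^sup>2 * (u - v)"] wiener_sum_def)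
qed

text \<open>
  Pathwise convergence of the finite sums is what makes the innovations random variables.
\<close>

lemma innovation_measurable:
  assumes "0 \<le> a" "a \<le> b"
  shows "random_variable borel (innovation B a b k)"
proof (rule borel_measurable_LIMSEQ_real[OF _ wiener_sum_measurable[OF assms, of k "\<lambda>j. if j = k then 1 else 0"]])
  fix \<omega> assume "\<omega> \<in> space M"
  from wiener_sum_tendsto[where B=B and n=k and c="\<lambda>j. if j = k then 1 else 0", OF continuous_paths[OF this] assms]
  show "(\<lambda>N. wiener_sum B k (\<lambda>j. if j = k then 1 else 0) a b N \<omega>) \<longlonglongrightarrow> innovation B a b k \<omega>"
    by (simp add: if_distrib[of "\<lambda>x. x * _"] cong: if_cong)
qed

lemma innovation_from_0: "innovation B 0 b k \<omega> = iter_int B k b \<omega> - b ^ k / fact k * B 0 \<omega>"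
proof -
  have zero: "iter_int B j 0 \<omega> = 0" if "0 < j" for j
    using that by (cases j) auto
  have "(\<Sum>j\<le>k. b ^ (k - j) / fact (k - j) * iter_int B j 0 \<omega>)
      = (\<Sum>j\<in>{0}. b ^ (k - j) / fact (k - j) * iter_int B j 0 \<omega>)"
    by (rule sum.mono_neutral_right) (auto simp: zero)
  then show ?thesis by (simp add: innovation_def)
qed

lemma iter_int_measurable:
  assumes "0 \<le> b"
  shows "random_variable borel (iter_int B k b)"
proof -
  have [measurable]: "random_variable borel (innovation B 0 b k)" "random_variable borel (B 0)"
    using assms by (auto intro: innovation_measurable random_variable_B)
  have "iter_int B k b = (\<lambda>\<omega>. innovation B 0 b k \<omega> + b ^ k / fact k * B 0 \<omega>)"
    by (simp add: innovation_from_0 fun_eq_iff)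
  then show ?thesis by simp
qed

text \<open>
  The characteristic functions of the finite sums converge by dominated convergence. The state at time
  \<open>s\<close> is almost surely its own innovation from time 0, because \<open>B\<close> starts at 0.
\<close>

lemma char_state_innovation:
  assumes s: "0 \<le> s" and t: "0 \<le> t"
  shows "(CLINT \<omega>|M. iexp ((\<Sum>k\<le>n. c k * iter_int B k s \<omega>) + (\<Sum>k\<le>n. d k * innovation B s (s + t) k \<omega>)))
    = of_real (exp (- (cov_form n s c + cov_form n t d) / 2))"
proof -
  have [measurable]: "random_variable borel (iter_int B k s)" "random_variable borel (innovation B s (s + t) k)" for k
    using s t by (auto intro: iter_int_measurable innovation_measurable)
  have [measurable]: "random_variable borel (wiener_sum B n c 0 s N)" "random_variable borel (wiener_sum B n d s (s + t) N)" for N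
    using s t by (auto intro: wiener_sum_measurable)
  have "(\<lambda>N. CLINT \<omega>|M. iexp (wiener_sum B n c 0 s N \<omega> + wiener_sum B n d s (s + t) N \<omega>))
    \<longlonglongrightarrow> (CLINT \<omega>|M. iexp ((\<Sum>k\<le>n. c k * iter_int B k s \<omega>) + (\<Sum>k\<le>n. d k * innovation B s (s + t) k \<omega>)))"
  proof (rule integral_dominated_convergence[where w="\<lambda>_. 1"])
    show "AE \<omega> in M. (\<lambda>N. iexp (wiener_sum B n c 0 s N \<omega> + wiener_sum B n d s (s + t) N \<omega>))
      \<longlonglongrightarrow> iexp ((\<Sum>k\<le>n. c k * iter_int B k s \<omega>) + (\<Sum>k\<le>n. d k * innovation B s (s + t) k \<omega>))"
      using starts_at_0 AE_space
    proof eventually_elim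
      case (elim \<omega>)
      note cont = continuous_paths[OF elim(2)]
      have "(\<lambda>N. wiener_sum B n c 0 s N \<omega>) \<longlonglongrightarrow> (\<Sum>k\<le>n. c k * iter_int B k s \<omega>)"
        using wiener_sum_tendsto[where B=B, OF cont order_refl s, where n=n and c=c] elim(1) by (simp add: innovation_from_0)
      moreover have "(\<lambda>N. wiener_sum B n d s (s + t) N \<omega>) \<longlonglongrightarrow> (\<Sum>k\<le>n. d k * innovation B s (s + t) k \<omega>)"
        using wiener_sum_tendsto[where B=B, OF cont s, where b="s + t" and n=n and c=d] t by simp
      ultimately show ?case by (intro tendsto_intros)
    qed
  qed (simp_all del: of_real_add of_real_sum)
  moreover have "(\<lambda>N. CLINT \<omega>|M. iexp (wiener_sum B n c 0 s N \<omega> + wiener_sum B n d s (s + t) N \<omega>))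
    \<longlonglongrightarrow> of_real (exp (- (cov_form n s c + cov_form n t d) / 2))"
    unfolding char_wiener_sums[OF s t]
    using wiener_variance_tendsto[where a=0 and b=s and n=n and c=c] wiener_variance_tendsto[where a=s and b="s + t" and n=n and c=d] s t
    by (intro tendsto_intros) auto
  ultimately show ?thesis by (rule LIMSEQ_unique)
qed

end

section \<open>Triangular changes of variables\<close>

definition triangular_map :: "nat set \<Rightarrow> (nat \<Rightarrow> nat \<Rightarrow> real) \<Rightarrow> (nat \<Rightarrow> real) \<Rightarrow> (nat \<Rightarrow> real) \<Rightarrow> nat \<Rightarrow> real" where
  "triangular_map J L b x = (\<lambda>j\<in>J. b j + (\<Sum>k\<le>j. L j k * x k))"

lemma triangular_map_measurable:
  assumes "\<And>j. j \<in> J \<Longrightarrow> {..j} \<subseteq> J"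
  shows "triangular_map J L b \<in> (\<Pi>\<^sub>M k\<in>J. lborel) \<rightarrow>\<^sub>M (\<Pi>\<^sub>M k\<in>J. lborel)"
  unfolding triangular_map_def
proof (rule measurable_restrict)
  fix j assume "j \<in> J"
  then have "(\<lambda>x. x k) \<in> (\<Pi>\<^sub>M k\<in>J. lborel) \<rightarrow>\<^sub>M (borel :: real measure)" if "k \<le> j" for k
    using assms[of j] that measurable_component_singleton[of k J "\<lambda>_. lborel"] by auto
  then show "(\<lambda>x. b j + (\<Sum>k\<le>j. L j k * x k)) \<in> (\<Pi>\<^sub>M k\<in>J. lborel) \<rightarrow>\<^sub>M lborel"
    by simp
qed

text \<open>
  Integrating out the last coordinate first is a one-dimensional affine substitution, since the other
  output coordinates do not involve it.
\<close>

lemma nn_integral_triangular_map_lessThan: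
  assumes "\<And>j. j < n \<Longrightarrow> L j j \<noteq> 0" and "f \<in> borel_measurable (\<Pi>\<^sub>M k\<in>{..<n}. lborel)"
  shows "(\<integral>\<^sup>+x. f x \<partial>(\<Pi>\<^sub>M k\<in>{..<n}. lborel))
    = ennreal \<bar>\<Prod>j<n. L j j\<bar> * (\<integral>\<^sup>+x. f (triangular_map {..<n} L b x) \<partial>(\<Pi>\<^sub>M k\<in>{..<n}. lborel))"
  using assms
proof (induction n arbitrary: f)
  case 0
  interpret product_sigma_finite "\<lambda>_::nat. lborel :: real measure" ..
  show ?case
    by (simp add: PiM_empty nn_integral_count_space_finite triangular_map_def)
next
  case (Suc n)
  interpret product_sigma_finite "\<lambda>_::nat. lborel :: real measure" ..
  let ?P = "\<Pi>\<^sub>M k\<in>{..<n}. lborel :: real measure"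
  let ?t = "\<lambda>x :: nat \<Rightarrow> real. b n + (\<Sum>k<n. L n k * x k)"
  have f[measurable]: "f \<in> borel_measurable (\<Pi>\<^sub>M k\<in>insert n {..<n}. lborel)"
    using Suc.prems(2) by (simp add: lessThan_Suc)
  have T: "triangular_map (insert n {..<n}) L b \<in> (\<Pi>\<^sub>M k\<in>insert n {..<n}. lborel) \<rightarrow>\<^sub>M (\<Pi>\<^sub>M k\<in>insert n {..<n}. lborel)"
    by (intro triangular_map_measurable) auto
  have T'[measurable]: "triangular_map {..<n} L b \<in> ?P \<rightarrow>\<^sub>M ?P"
    by (intro triangular_map_measurable) auto
  have upd: "triangular_map (insert n {..<n}) L b (x(n := y)) = (triangular_map {..<n} L b x)(n := ?t x + L n n * y)" for x y
  proof
    fix j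
    have "{..n} = insert n {..<n}" by auto
    moreover have "(\<Sum>k\<le>j. L j k * (x(n := y)) k) = (\<Sum>k\<le>j. L j k * x k)" if "j < n"
      using that by (intro sum.cong) auto
    ultimately show "triangular_map (insert n {..<n}) L b (x(n := y)) j = ((triangular_map {..<n} L b x)(n := ?t x + L n n * y)) j"
      by (auto simp: triangular_map_def)
  qed
  define g where "g = (\<lambda>x. f (triangular_map (insert n {..<n}) L b x))"
  have g[measurable]: "g \<in> borel_measurable (\<Pi>\<^sub>M k\<in>insert n {..<n}. lborel)"
    unfolding g_def using T f by (rule measurable_compose)
  define F where "F = (\<lambda>z. \<integral>\<^sup>+y. f (z(n := y)) \<partial>lborel)"
  have F[measurable]: "F \<in> borel_measurable ?P"
    unfolding F_def by measurable
  have inner: "F (triangular_map {..<n} L b x) = ennreal \<bar>L n n\<bar> * (\<integral>\<^sup>+y. g (x(n := y)) \<partial>lborel)"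
    if "x \<in> space ?P" for x
  proof -
    have "triangular_map {..<n} L b x \<in> space ?P"
      using measurable_space[OF T' that] .
    then have "(\<lambda>y. f ((triangular_map {..<n} L b x)(n := y))) \<in> borel_measurable borel"
      by measurable
    then show ?thesis
      unfolding F_def g_def upd using Suc.prems(1)[of n] by (subst nn_integral_real_affine[where c="L n n" and t="?t x"]) auto
  qed
  have "(\<integral>\<^sup>+x. f x \<partial>(\<Pi>\<^sub>M k\<in>insert n {..<n}. lborel)) = (\<integral>\<^sup>+x. F x \<partial>?P)"
    unfolding F_def by (rule product_nn_integral_insert) auto
  also have "\<dots> = ennreal \<bar>\<Prod>j<n. L j j\<bar> * (\<integral>\<^sup>+x. F (triangular_map {..<n} L b x) \<partial>?P)"
    by (rule Suc.IH) (use Suc.prems(1) in auto)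
  also have "(\<integral>\<^sup>+x. F (triangular_map {..<n} L b x) \<partial>?P)
      = (\<integral>\<^sup>+x. ennreal \<bar>L n n\<bar> * (\<integral>\<^sup>+y. g (x(n := y)) \<partial>lborel) \<partial>?P)"
    by (intro nn_integral_cong inner)
  also have "\<dots> = ennreal \<bar>L n n\<bar> * (\<integral>\<^sup>+x. (\<integral>\<^sup>+y. g (x(n := y)) \<partial>lborel) \<partial>?P)"
    by (intro nn_integral_cmult) measurable
  also have "(\<integral>\<^sup>+x. (\<integral>\<^sup>+y. g (x(n := y)) \<partial>lborel) \<partial>?P)
      = (\<integral>\<^sup>+x. g x \<partial>(\<Pi>\<^sub>M k\<in>insert n {..<n}. lborel))"
    by (rule product_nn_integral_insert[symmetric]) auto
  finally show ?case
    by (simp add: lessThan_Suc abs_mult ennreal_mult mult_ac g_def)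
qed

lemma nn_integral_triangular_map:
  assumes "\<And>j. j \<le> n \<Longrightarrow> L j j \<noteq> 0" and "f \<in> borel_measurable (lborel_vec n)"
  shows "(\<integral>\<^sup>+x. f x \<partial>lborel_vec n)
    = ennreal \<bar>\<Prod>j\<le>n. L j j\<bar> * (\<integral>\<^sup>+x. f (triangular_map {..n} L b x) \<partial>lborel_vec n)"
  using nn_integral_triangular_map_lessThan[of "Suc n" L f b] assms
  by (simp add: lessThan_Suc_atMost)

fun forward_subst :: "(nat \<Rightarrow> nat \<Rightarrow> real) \<Rightarrow> (nat \<Rightarrow> real) \<Rightarrow> nat \<Rightarrow> real" where
  "forward_subst L y j = (y j - (\<Sum>k<j. L j k * forward_subst L y k)) / L j j"

declare forward_subst.simps [simp del]

lemma forward_subst_triangular_map: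
  assumes "\<And>j. j \<le> n \<Longrightarrow> L j j \<noteq> 0" and "j \<le> n"
  shows "forward_subst L (triangular_map {..n} L (\<lambda>_. 0) x) j = x j"
  using assms(2)
proof (induction j rule: less_induct)
  case (less j)
  have "(\<Sum>k\<le>j. L j k * x k) = (\<Sum>k<j. L j k * x k) + L j j * x j"
    by (simp add: lessThan_Suc_atMost[symmetric])
  moreover have "(\<Sum>k<j. L j k * forward_subst L (triangular_map {..n} L (\<lambda>_. 0) x) k) = (\<Sum>k<j. L j k * x k)"
    using less by (intro sum.cong) auto
  ultimately show ?case
    using less.prems assms(1)[of j] by (subst forward_subst.simps) (simp add: triangular_map_def)
qed

lemma forward_subst_measurable:
  "j \<le> n \<Longrightarrow> (\<lambda>y. forward_subst L y j) \<in> borel_measurable (lborel_vec n)"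
proof (induction j rule: less_induct)
  case (less j)
  have [measurable]: "(\<lambda>y. y j) \<in> borel_measurable (lborel_vec n)"
    using measurable_component_singleton[of j "{..n}" "\<lambda>_. lborel :: real measure"] less.prems by simp
  have [measurable]: "(\<lambda>y. forward_subst L y k) \<in> borel_measurable (lborel_vec n)" if "k \<in> {..<j}" for k
    using less that by auto
  show ?case
    by (subst forward_subst.simps) measurable
qed

section \<open>The Gaussian density\<close>

text \<open>
  The stationary density \<open>p\<^sub>n\<close>.
\<close>

definition gauss_kernel :: "nat \<Rightarrow> (nat \<Rightarrow> real) \<Rightarrow> real" where
  "gauss_kernel n x = K_const n * (let v = mat_vec n A_mat x in exp (- (1/2) * vec_inner n v (mat_vec n Lambda_mat v)))"

text \<open>
  The density of \<open>W(t)\<close> for \<open>t > 0\<close>.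
\<close>

definition scaled_kernel :: "nat \<Rightarrow> real \<Rightarrow> (nat \<Rightarrow> real) \<Rightarrow> real" where
  "scaled_kernel n t x = t powr (- (1/2) * (real n + 1)\<^sup>2) * gauss_kernel n (mat_vec n (T_mat t) x)"

lemma mat_vec_T_mat: "k \<le> n \<Longrightarrow> mat_vec n (T_mat t) x k = t powr (- (real k + 1/2)) * x k"
proof -
  assume k: "k \<le> n"
  have "(\<Sum>l\<le>n. T_mat t k l * x l) = (\<Sum>l\<in>{k}. T_mat t k l * x l)"
    using k by (intro sum.mono_neutral_right) (auto simp: T_mat_def)
  then show ?thesis using k by (simp add: mat_vec_def T_mat_def)
qed

lemma mat_vec_Lambda_mat: "k \<le> n \<Longrightarrow> mat_vec n Lambda_mat x k = (2 * real k + 1) * x k"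
proof -
  assume k: "k \<le> n"
  have "(\<Sum>l\<le>n. Lambda_mat k l * x l) = (\<Sum>l\<in>{k}. Lambda_mat k l * x l)"
    using k by (intro sum.mono_neutral_right) (auto simp: Lambda_mat_def)
  then show ?thesis using k by (simp add: mat_vec_def Lambda_mat_def)
qed

lemma A_mat_nonzeroD: "A_mat j k \<noteq> 0 \<Longrightarrow> k \<le> j"
  by (simp add: A_mat_def split: if_splits)

lemma mat_vec_A_mat: "j \<le> n \<Longrightarrow> mat_vec n A_mat x j = (\<Sum>k\<le>j. A_mat j k * x k)"
  unfolding mat_vec_def by (auto dest: A_mat_nonzeroD intro!: sum.mono_neutral_right)

lemma gauss_kernel_alt:
  "gauss_kernel n x = K_const n * exp (- (\<Sum>j\<le>n. (sqrt (2 * real j + 1) * (\<Sum>k\<le>j. A_mat j k * x k))\<^sup>2) / 2)"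
proof -
  have "vec_inner n (mat_vec n A_mat x) (mat_vec n Lambda_mat (mat_vec n A_mat x))
      = (\<Sum>j\<le>n. (sqrt (2 * real j + 1) * (\<Sum>k\<le>j. A_mat j k * x k))\<^sup>2)"
    unfolding vec_inner_def
    by (intro sum.cong refl) (simp add: mat_vec_Lambda_mat mat_vec_A_mat power_mult_distrib power2_eq_square[of "sum _ _"])
  then show ?thesis by (simp add: gauss_kernel_def Let_def)
qed

text \<open>
  The triangular matrix \<open>\<Lambda>\<^sup>1\<^sup>/\<^sup>2 A T(t)\<close>, which transforms \<open>W(t)\<close> into a standard normal vector.
\<close>

definition std_mat :: "real \<Rightarrow> nat \<Rightarrow> nat \<Rightarrow> real" where
  "std_mat t j k = sqrt (2 * real j + 1) * A_mat j k * t powr (- (real k + 1/2))"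

lemma A_mat_diag_pos: "0 < A_mat j j"
  by (simp add: A_mat_def)

lemma K_const_pos: "0 < K_const n"
  unfolding K_const_eq by (intro mult_pos_pos prod_pos zero_less_power) (auto simp: A_mat_diag_pos)

text \<open>
  The density is the substitution of \<open>\<Lambda>\<^sup>1\<^sup>/\<^sup>2 A T(t) x\<close> into the standard normal density, times the
  determinant.
\<close>

lemma scaled_kernel_std:
  assumes t: "0 < t"
  shows "scaled_kernel n t x = \<bar>\<Prod>j\<le>n. std_mat t j j\<bar> * (\<Prod>j\<le>n. std_normal_density (triangular_map {..n} (std_mat t) (\<lambda>_. 0) x j))"
proof -
  have det: "(\<Prod>j\<le>n. std_mat t j j) = (\<Prod>j\<le>n. sqrt (2 * real j + 1) * A_mat j j) * t powr (- (1/2) * (real n + 1)\<^sup>2)"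
  proof -
    have "(\<Prod>j\<le>n. t powr (- (real j + 1/2))) = t powr (\<Sum>j\<le>n. - (real j + 1/2))"
      using t by (simp add: powr_sum)
    also have "(\<Sum>j\<le>n. - (real j + 1/2)) = - (1/2) * (real n + 1)\<^sup>2"
      by (induction n) (simp_all add: power2_eq_square field_simps)
    finally show ?thesis by (simp add: std_mat_def prod.distrib)
  qed
  have tri: "triangular_map {..n} (std_mat t) (\<lambda>_. 0) x j = sqrt (2 * real j + 1) * (\<Sum>k\<le>j. A_mat j k * mat_vec n (T_mat t) x k)"
    if "j \<le> n" for j
    using that unfolding triangular_map_def sum_distrib_left
    by (auto simp: std_mat_def mat_vec_T_mat mult_ac intro!: sum.cong)
  have "(\<Prod>j\<le>n. std_normal_density (y j)) = (1 / sqrt (2 * pi)) ^ (n + 1) * exp (- (\<Sum>j\<le>n. (y j)\<^sup>2) / 2)" for y :: "nat \<Rightarrow> real"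
    by (simp only: std_normal_density_def prod.distrib prod_constant card_atMost exp_sum[OF finite_atMost, symmetric] sum_negf[symmetric] sum_divide_distrib) simp
  moreover have "0 < (\<Prod>j\<le>n. std_mat t j j)"
    using t by (intro prod_pos) (auto simp: std_mat_def A_mat_diag_pos)
  moreover have "(\<Sum>j\<le>n. (triangular_map {..n} (std_mat t) (\<lambda>_. 0) x j)\<^sup>2)
      = (\<Sum>j\<le>n. (sqrt (2 * real j + 1) * (\<Sum>k\<le>j. A_mat j k * mat_vec n (T_mat t) x k))\<^sup>2)"
    by (intro sum.cong) (auto simp: tri)
  ultimately show ?thesis
    by (simp add: scaled_kernel_def gauss_kernel_alt K_const_eq det)
qed

text \<open>
  Brownian scaling: \<open>T(t) W(t)\<close> has the same covariances as \<open>W(1)\<close>.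
\<close>

lemma cov_form_scale:
  assumes t: "0 < t"
  shows "cov_form n t (\<lambda>k. c k * t powr (- (real k + 1/2))) = cov_form n 1 c"
  unfolding cov_form_def
proof (intro sum.cong refl)
  fix j k
  have "t powr (- (real j + 1/2)) * t powr (- (real k + 1/2)) * t ^ (j + k + 1) = 1"
    using t by (simp add: powr_realpow[symmetric] powr_add[symmetric] del: power_Suc)
  then show "c j * t powr - (real j + 1 / 2) * (c k * t powr - (real k + 1 / 2)) * (t ^ (j + k + 1) / (real (j + k + 1) * fact j * fact k))
      = c j * c k * (1 ^ (j + k + 1) / (real (j + k + 1) * fact j * fact k))"
    by (simp add: field_simps)
qed

lemma sum_swap2:
  "(\<Sum>k\<in>A. \<Sum>l\<in>B. \<Sum>i\<in>C. \<Sum>j\<in>D. f k l i j) = (\<Sum>i\<in>C. \<Sum>j\<in>D. \<Sum>k\<in>A. \<Sum>l\<in>B. f k l i j)"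
proof -
  have "(\<Sum>k\<in>A. \<Sum>l\<in>B. \<Sum>i\<in>C. \<Sum>j\<in>D. f k l i j) = (\<Sum>k\<in>A. \<Sum>i\<in>C. \<Sum>j\<in>D. \<Sum>l\<in>B. f k l i j)"
    by (subst sum.swap[of _ B], subst (2) sum.swap[of _ B]) (rule refl)
  also have "\<dots> = (\<Sum>i\<in>C. \<Sum>k\<in>A. \<Sum>j\<in>D. \<Sum>l\<in>B. f k l i j)"
    by (rule sum.swap)
  also have "\<dots> = (\<Sum>i\<in>C. \<Sum>j\<in>D. \<Sum>k\<in>A. \<Sum>l\<in>B. f k l i j)"
    by (rule sum.cong[OF refl], rule sum.swap)
  finally show ?thesis .
qed

lemma cov_form_orthonormal:
  "cov_form n 1 (\<lambda>k. \<Sum>j\<le>n. \<theta> j * (sqrt (2 * real j + 1) * A_mat j k)) = (\<Sum>j\<le>n. (\<theta> j)\<^sup>2)"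
proof -
  define b where "b = (\<lambda>j. \<theta> j * sqrt (2 * real j + 1))"
  have "cov_form n 1 (\<lambda>k. \<Sum>j\<le>n. b j * A_mat j k)
      = (\<Sum>k\<le>n. \<Sum>l\<le>n. \<Sum>i\<le>n. \<Sum>j\<le>n. b i * b j * (A_mat i k * A_mat j l / (real (k + l + 1) * fact k * fact l)))"
    unfolding cov_form_def sum_product
    unfolding sum_distrib_right by (intro sum.cong refl) simp
  also have "\<dots> = (\<Sum>i\<le>n. \<Sum>j\<le>n. \<Sum>k\<le>n. \<Sum>l\<le>n. b i * b j * (A_mat i k * A_mat j l / (real (k + l + 1) * fact k * fact l)))"
    by (rule sum_swap2)
  also have "\<dots> = (\<Sum>i\<le>n. \<Sum>j\<le>n. b i * b j * (if i = j then 1 / (2 * real j + 1) else 0))"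
    by (intro sum.cong refl) (simp only: sum_distrib_left[symmetric], subst A_mat_orthogonal, auto)
  also have "\<dots> = (\<Sum>i\<le>n. (\<theta> i)\<^sup>2)"
  proof (intro sum.cong refl)
    fix i assume "i \<in> {..n}"
    moreover have "b i * b i = (\<theta> i)\<^sup>2 * (2 * real i + 1)"
      by (simp add: b_def power2_eq_square[symmetric] power_mult_distrib)
    ultimately show "(\<Sum>j\<le>n. b i * b j * (if i = j then 1 / (2 * real j + 1) else 0)) = (\<theta> i)\<^sup>2"
      by (simp add: if_distrib cong: if_cong)
  qed
  finally show ?thesis by (simp add: b_def mult.assoc)
qed

lemma scaled_kernel_measurable: "scaled_kernel n t \<in> borel_measurable (lborel_vec n)"
proof -
  have [measurable]: "(\<lambda>x. x k) \<in> borel_measurable (lborel_vec n)" if "k \<in> {..n}" for k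
    using measurable_component_singleton[OF that, of "\<lambda>_. lborel :: real measure"] by simp
  have "scaled_kernel n t = (\<lambda>x. t powr (- (1/2) * (real n + 1)\<^sup>2) * (K_const n * exp (- (\<Sum>j\<le>n. (sqrt (2 * real j + 1) * (\<Sum>k\<in>{..j} \<inter> {..n}. A_mat j k * (t powr (- (real k + 1/2)) * x k)))\<^sup>2) / 2)))"
    unfolding scaled_kernel_def gauss_kernel_alt
    by (auto simp: fun_eq_iff mat_vec_T_mat Int_absorb2 intro!: arg_cong[where f=exp] sum.cong)
  then show ?thesis by (simp only:) measurable
qed

lemma scaled_kernel_nonneg: "0 \<le> scaled_kernel n t x"
  using K_const_pos[of n] by (simp add: scaled_kernel_def gauss_kernel_alt)

text \<open>
  By its characteristic function, the transformed vector is standard normal. So is the transform of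
  the measure with the claimed density, by the change of variables formula. Applying the inverse
  transformation (forward substitution) to both laws gives the claim.
\<close>

lemma (in prob_space) distributed_scaled_kernel:
  assumes t: "0 < t" and U: "\<And>k. k \<le> n \<Longrightarrow> random_variable borel (U k)"
    and char: "\<And>c. (CLINT \<omega>|M. iexp (\<Sum>k\<le>n. c k * U k \<omega>)) = of_real (exp (- cov_form n t c / 2))"
  shows "distributed M (lborel_vec n) (\<lambda>\<omega>. \<lambda>k\<in>{..n}. U k \<omega>) (scaled_kernel n t)"
proof -
  let ?P = "lborel_vec n" and ?U = "\<lambda>\<omega>. \<lambda>k\<in>{..n}. U k \<omega>" and ?L = "std_mat t"
  let ?tri = "triangular_map {..n} ?L (\<lambda>_. 0)"
  let ?\<phi> = "\<lambda>x. \<Prod>j\<le>n. ennreal (std_normal_density (x j))"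
  let ?inv = "\<lambda>y. \<lambda>j\<in>{..n}. forward_subst ?L y j"
  define D where "D = density ?P (scaled_kernel n t)"
  have [measurable]: "scaled_kernel n t \<in> borel_measurable ?P" by (rule scaled_kernel_measurable)
  have Um[measurable]: "?U \<in> M \<rightarrow>\<^sub>M ?P"
    using U by (intro measurable_restrict) auto
  have tri[measurable]: "?tri \<in> ?P \<rightarrow>\<^sub>M ?P"
    by (rule triangular_map_measurable) auto
  have inv[measurable]: "?inv \<in> ?P \<rightarrow>\<^sub>M ?P"
    using forward_subst_measurable by (intro measurable_restrict) auto
  have \<phi>[measurable]: "?\<phi> \<in> borel_measurable ?P"
    by measurable
  have diag: "?L j j \<noteq> 0" for j
    using t A_mat_diag_pos[of j] by (auto simp: std_mat_def)
  have inv_tri: "?inv (?tri x) = x" if "x \<in> space ?P" for x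
    using that by (auto simp: fun_eq_iff space_PiM PiE_iff extensional_def forward_subst_triangular_map[OF diag])
  have "distr M ?P (\<lambda>\<omega>. ?tri (?U \<omega>)) = distr M ?P (\<lambda>\<omega>. \<lambda>j\<in>{..n}. \<Sum>k\<le>n. ?L j k * U k \<omega>)"
  proof (rule distr_cong)
    fix \<omega>
    show "?tri (?U \<omega>) = (\<lambda>j\<in>{..n}. \<Sum>k\<le>n. ?L j k * U k \<omega>)"
      unfolding triangular_map_def
      by (intro restrict_ext, simp, intro sum.mono_neutral_cong_left) (auto simp: std_mat_def dest: A_mat_nonzeroD)
  qed auto
  also have "\<dots> = density ?P ?\<phi>"
  proof (rule distr_std_normal_of_char)
    fix \<theta> :: "nat \<Rightarrow> real"
    have "(\<Sum>j\<le>n. \<theta> j * (\<Sum>k\<le>n. ?L j k * u k)) = (\<Sum>k\<le>n. ((\<Sum>j\<le>n. \<theta> j * (sqrt (2 * real j + 1) * A_mat j k)) * t powr (- (real k + 1/2))) * u k)" for u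
      unfolding sum_distrib_left sum_distrib_right by (subst sum.swap) (simp add: std_mat_def mult.assoc)
    then show "(CLINT \<omega>|M. iexp (\<Sum>j\<le>n. \<theta> j * (\<Sum>k\<le>n. ?L j k * U k \<omega>))) = of_real (exp (- (\<Sum>j\<le>n. (\<theta> j)\<^sup>2) / 2))"
      by (simp only: char cov_form_scale[OF t] cov_form_orthonormal)
  qed (use U in \<open>auto intro: finite_measure_axioms\<close>)
  also have "\<dots> = distr D ?P ?tri"
  proof (rule measure_eqI)
    fix E assume "E \<in> sets (density ?P ?\<phi>)"
    then have E[measurable]: "E \<in> sets ?P" by simp
    have [measurable]: "(\<lambda>x. ?\<phi> x * indicator E x) \<in> borel_measurable ?P" by measurable
    have "emeasure (density ?P ?\<phi>) E = (\<integral>\<^sup>+x. ?\<phi> x * indicator E x \<partial>?P)"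
      by (simp add: emeasure_density)
    also have "\<dots> = ennreal \<bar>\<Prod>j\<le>n. ?L j j\<bar> * (\<integral>\<^sup>+x. ?\<phi> (?tri x) * indicator E (?tri x) \<partial>?P)"
      by (rule nn_integral_triangular_map[OF diag]) simp
    also have "\<dots> = (\<integral>\<^sup>+x. ennreal \<bar>\<Prod>j\<le>n. ?L j j\<bar> * (?\<phi> (?tri x) * indicator E (?tri x)) \<partial>?P)"
      by (rule nn_integral_cmult[symmetric]) (rule measurable_compose[OF tri], simp)
    also have "\<dots> = (\<integral>\<^sup>+x. ennreal (scaled_kernel n t x) * indicator (?tri -` E \<inter> space ?P) x \<partial>?P)"
      by (intro nn_integral_cong)
        (auto simp: scaled_kernel_std[OF t] ennreal_mult prod_ennreal prod_nonneg split: split_indicator)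
    also have "\<dots> = emeasure (distr D ?P ?tri) E"
      unfolding D_def by (simp add: emeasure_distr emeasure_density measurable_sets[OF tri E])
    finally show "emeasure (density ?P ?\<phi>) E = emeasure (distr D ?P ?tri) E" .
  qed simp
  finally have eq: "distr M ?P (\<lambda>\<omega>. ?tri (?U \<omega>)) = distr D ?P ?tri" .
  have "distr M ?P ?U = distr M ?P (\<lambda>\<omega>. ?inv (?tri (?U \<omega>)))"
    using measurable_space[OF Um] by (intro distr_cong refl) (simp only: inv_tri)
  also have "\<dots> = distr (distr M ?P (\<lambda>\<omega>. ?tri (?U \<omega>))) ?P ?inv"
    by (subst distr_distr) (auto simp: comp_def)
  also have "\<dots> = distr (distr D ?P ?tri) ?P ?inv"
    by (simp only: eq)
  also have "\<dots> = distr D ?P (\<lambda>x. ?inv (?tri x))"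
    by (subst distr_distr) (auto simp: comp_def D_def)
  also have "\<dots> = distr D D (\<lambda>x. x)"
    by (intro distr_cong) (simp_all add: D_def inv_tri del: restrict_apply)
  also have "\<dots> = D" by simp
  finally show ?thesis
    unfolding distributed_def D_def by simp
qed

section \<open>Separating continuous densities by boxes\<close>

text \<open>
  The coordinates with index above \<open>n\<close> of a vector are fixed to the default value, so only the finitely
  many others are restricted by the box.
\<close>

lemma open_contains_box:
  fixes x :: "nat \<Rightarrow> real"
  assumes U: "open U" and x: "x \<in> U" "x \<in> vecs n"
  obtains E where "E \<in> sets (lborel_vec n)" "x \<in> E" "E \<subseteq> U \<inter> vecs n" "0 < emeasure (lborel_vec n) E" "emeasure (lborel_vec n) E < \<infinity>"
proof -
  interpret product_sigma_finite "\<lambda>_::nat. lborel :: real measure" ..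
  from product_topology_open_contains_basis[OF U[unfolded open_fun_def] x(1)]
  obtain X where X: "x \<in> (\<Pi>\<^sub>E i\<in>UNIV. X i)" "\<And>i. open (X i)" "(\<Pi>\<^sub>E i\<in>UNIV. X i) \<subseteq> U"
    by auto
  have "\<exists>e>0. {x i - e<..<x i + e} \<subseteq> X i" for i
  proof -
    have "x i \<in> X i" using X(1) by (simp add: PiE_iff)
    then obtain e where "0 < e" "ball (x i) e \<subseteq> X i"
      using X(2)[of i] open_contains_ball[of "X i"] by blast
    moreover have "{x i - e<..<x i + e} = ball (x i) e"
      by (simp add: ball_eq_greaterThanLessThan)
    ultimately show ?thesis by auto
  qed
  then obtain e where e: "\<And>i. 0 < e i" "\<And>i. {x i - e i<..<x i + e i} \<subseteq> X i"
    by metis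
  define E where "E = (\<Pi>\<^sub>E i\<in>{..n}. {x i - e i<..<x i + e i})"
  have undef: "undefined \<in> X i" if "\<not> i \<le> n" for i
  proof -
    have "x i = undefined" using x(2) that by (intro PiE_arb) auto
    moreover have "x i \<in> X i" using X(1) by (rule PiE_mem) simp
    ultimately show ?thesis by simp
  qed
  have "E \<subseteq> (\<Pi>\<^sub>E i\<in>UNIV. X i)"
  proof
    fix y assume y: "y \<in> E"
    have "y i \<in> X i" for i
      using y e(2)[of i] undef[of i] by (cases "i \<le> n") (auto simp: E_def PiE_iff extensional_def)
    then show "y \<in> (\<Pi>\<^sub>E i\<in>UNIV. X i)" by auto
  qed
  moreover have "emeasure (lborel_vec n) E = (\<Prod>i\<le>n. ennreal (2 * e i))"
    unfolding E_def using e(1) by (subst emeasure_PiM) (auto intro!: prod.cong simp: less_imp_le)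
  then have "emeasure (lborel_vec n) E = ennreal (\<Prod>i\<le>n. 2 * e i)"
    using e(1) by (simp add: prod_ennreal less_imp_le)
  moreover have "0 < (\<Prod>i\<le>n. 2 * e i)"
    using e(1) by (intro prod_pos) auto
  moreover have "x \<in> E"
    using x(2) e(1) by (auto simp: E_def PiE_iff)
  moreover have "E \<in> sets (lborel_vec n)"
    unfolding E_def by (intro sets_PiM_I_finite) auto
  moreover have "E \<subseteq> vecs n" by (auto simp: E_def PiE_iff)
  ultimately show ?thesis
    using X(3) by (intro that[of E]) auto
qed

text \<open>
  Two constants \<open>c1 > c2\<close> strictly between the values at \<open>(a, w)\<close> separate the functions on a
  neighbourhood, which contains a product of two boxes. The box \<open>D\<close> has finite positive measure, so
  the integrals over it are separated strictly.
\<close>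

lemma separating_boxes:
  fixes f g :: "(nat \<Rightarrow> real) \<Rightarrow> (nat \<Rightarrow> real) \<Rightarrow> real"
  assumes f: "continuous_on (vecs n \<times> vecs n) (\<lambda>(a, w). f a w)" and g: "continuous_on (vecs n \<times> vecs n) (\<lambda>(a, w). g a w)"
    and g_nonneg: "0 \<le> g a w" and a: "a \<in> vecs n" and w: "w \<in> vecs n" and less: "g a w < f a w"
  obtains E D where "E \<in> sets (lborel_vec n)" "D \<in> sets (lborel_vec n)" "0 < emeasure (lborel_vec n) E"
    "\<And>b. b \<in> E \<Longrightarrow> (\<integral>\<^sup>+v\<in>D. ennreal (g b v) \<partial>lborel_vec n) < (\<integral>\<^sup>+v\<in>D. ennreal (f b v) \<partial>lborel_vec n)"
proof -
  let ?S = "vecs n \<times> vecs n"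
  obtain c2 where c2: "g a w < c2" "c2 < f a w" using dense[OF less] by blast
  obtain c1 where c1: "c2 < c1" "c1 < f a w" using dense[OF c2(2)] by blast
  have c2_pos: "0 < c2" using g_nonneg c2 by simp
  have "openin (top_of_set ?S) (?S \<inter> (\<lambda>(a, w). f a w) -` {c1<..})"
    using f by (rule continuous_openin_preimage_gen) simp
  then obtain F where F: "open F" "?S \<inter> (\<lambda>(a, w). f a w) -` {c1<..} = ?S \<inter> F"
    by (auto simp: openin_open)
  have "openin (top_of_set ?S) (?S \<inter> (\<lambda>(a, w). g a w) -` {..<c2})"
    using g by (rule continuous_openin_preimage_gen) simp
  then obtain G where G: "open G" "?S \<inter> (\<lambda>(a, w). g a w) -` {..<c2} = ?S \<inter> G"
    by (auto simp: openin_open)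
  have "(a, w) \<in> ?S \<inter> (\<lambda>(a, w). f a w) -` {c1<..}" "(a, w) \<in> ?S \<inter> (\<lambda>(a, w). g a w) -` {..<c2}"
    using a w c1 c2 by auto
  then have "(a, w) \<in> F \<inter> G" unfolding F(2) G(2) by simp
  then obtain U V where UV: "open U" "open V" "a \<in> U" "w \<in> V" "U \<times> V \<subseteq> F \<inter> G"
    using open_prod_elim[of "F \<inter> G" "(a, w)"] F(1) G(1) by (metis open_Int mem_Sigma_iff)
  obtain E where E: "E \<in> sets (lborel_vec n)" "E \<subseteq> U \<inter> vecs n" "0 < emeasure (lborel_vec n) E"
    using open_contains_box[OF UV(1,3) a] by metis
  obtain D where D: "D \<in> sets (lborel_vec n)" "D \<subseteq> V \<inter> vecs n" "0 < emeasure (lborel_vec n) D" "emeasure (lborel_vec n) D < \<infinity>"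
    using open_contains_box[OF UV(2,4) w] by metis
  show ?thesis
  proof (rule that[OF E(1) D(1) E(3)])
    fix b assume b: "b \<in> E"
    have mem: "(b, v) \<in> ?S \<inter> F" "(b, v) \<in> ?S \<inter> G" if "v \<in> D" for v
      using that b E(2) D(2) UV(5) by auto
    have bound: "c1 \<le> f b v" "g b v \<le> c2" if "v \<in> D" for v
      using mem[OF that] unfolding F(2)[symmetric] G(2)[symmetric] by auto
    have "(\<integral>\<^sup>+v\<in>D. ennreal (g b v) \<partial>lborel_vec n) \<le> (\<integral>\<^sup>+v. ennreal c2 * indicator D v \<partial>lborel_vec n)"
      using bound by (intro nn_integral_mono) (auto simp: ennreal_leI split: split_indicator)
    also have "\<dots> = ennreal c2 * emeasure (lborel_vec n) D"
      using D(1) by (simp add: nn_integral_cmult_indicator)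
    also have "\<dots> < ennreal c1 * emeasure (lborel_vec n) D"
      using D(3,4) c1(1) c2_pos by (intro ennreal_mult_strict_right_mono) (auto simp: ennreal_less_iff)
    also have "\<dots> = (\<integral>\<^sup>+v. ennreal c1 * indicator D v \<partial>lborel_vec n)"
      using D(1) by (simp add: nn_integral_cmult_indicator)
    also have "\<dots> \<le> (\<integral>\<^sup>+v\<in>D. ennreal (f b v) \<partial>lborel_vec n)"
      using bound by (intro nn_integral_mono) (auto simp: ennreal_leI split: split_indicator)
    finally show "(\<integral>\<^sup>+v\<in>D. ennreal (g b v) \<partial>lborel_vec n) < (\<integral>\<^sup>+v\<in>D. ennreal (f b v) \<partial>lborel_vec n)" .
  qed
qed

section \<open>The stationary density and the transition density\<close>

text \<open>
  The predicted state after time \<open>t\<close>, given the present state \<open>a\<close>.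
\<close>

definition taylor_shift :: "nat \<Rightarrow> real \<Rightarrow> (nat \<Rightarrow> real) \<Rightarrow> nat \<Rightarrow> real" where
  "taylor_shift n t a = (\<lambda>k\<in>{..n}. \<Sum>j\<le>k. t ^ (k - j) / fact (k - j) * a j)"

lemma mat_vec_cong: "(\<And>k. k \<le> n \<Longrightarrow> x k = y k) \<Longrightarrow> mat_vec n C x = mat_vec n C y"
  by (auto simp: mat_vec_def fun_eq_iff intro!: sum.cong)

lemma Gamma_mat_nonzeroD: "Gamma_mat j k \<noteq> 0 \<Longrightarrow> k \<le> j"
  by (simp add: Gamma_mat_def split: if_splits)

text \<open>
  The diagonal scaling conjugates the Taylor shift by time \<open>t\<close> into the Taylor shift by time 1, which
  is \<open>\<Gamma>\<close>.
\<close>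

lemma scaled_kernel_shift:
  assumes t: "0 < t"
  shows "scaled_kernel n t (vec_diff n w (taylor_shift n t a)) = t powr (- (1/2) * (real n + 1)\<^sup>2)
    * gauss_kernel n (vec_diff n (mat_vec n (T_mat t) w) (mat_vec n Gamma_mat (mat_vec n (T_mat t) a)))"
proof -
  have shift: "t powr (- (real k + 1/2)) * taylor_shift n t a k = mat_vec n Gamma_mat (mat_vec n (T_mat t) a) k"
    if k: "k \<le> n" for k
  proof -
    have "mat_vec n Gamma_mat (mat_vec n (T_mat t) a) k = (\<Sum>j\<le>k. Gamma_mat k j * mat_vec n (T_mat t) a j)"
      using k unfolding mat_vec_def[of n Gamma_mat] by (auto dest: Gamma_mat_nonzeroD intro!: sum.mono_neutral_right)
    also have "\<dots> = (\<Sum>j\<le>k. t powr (- (real k + 1/2)) * (t ^ (k - j) / fact (k - j) * a j))"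
    proof (intro sum.cong refl)
      fix j assume j: "j \<in> {..k}"
      then have "t powr (- (real k + 1/2)) * t ^ (k - j) = t powr (- (real j + 1/2))"
        using t by (simp add: powr_realpow[symmetric] powr_add[symmetric] of_nat_diff algebra_simps)
      then show "Gamma_mat k j * mat_vec n (T_mat t) a j = t powr (- (real k + 1/2)) * (t ^ (k - j) / fact (k - j) * a j)"
        using j k by (simp add: Gamma_mat_def mat_vec_T_mat)
    qed
    finally show ?thesis using k by (simp add: taylor_shift_def sum_distrib_left)
  qed
  have "mat_vec n (T_mat t) (vec_diff n w (taylor_shift n t a))
      = vec_diff n (mat_vec n (T_mat t) w) (mat_vec n Gamma_mat (mat_vec n (T_mat t) a))"
  proof
    fix k
    show "mat_vec n (T_mat t) (vec_diff n w (taylor_shift n t a)) k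
      = vec_diff n (mat_vec n (T_mat t) w) (mat_vec n Gamma_mat (mat_vec n (T_mat t) a)) k"
    proof (cases "k \<le> n")
      case True
      then have "mat_vec n (T_mat t) (vec_diff n w (taylor_shift n t a)) k
          = t powr (- (real k + 1/2)) * (w k - taylor_shift n t a k)"
        by (simp add: mat_vec_T_mat vec_diff_def)
      also have "\<dots> = t powr (- (real k + 1/2)) * w k - mat_vec n Gamma_mat (mat_vec n (T_mat t) a) k"
        unfolding right_diff_distrib shift[OF True] ..
      finally show ?thesis using True by (simp add: mat_vec_T_mat vec_diff_def)
    qed (simp add: mat_vec_def vec_diff_def)
  qed
  then show ?thesis by (simp add: scaled_kernel_def)
qed

lemma mat_vec_A_vec_diff_Gamma:
  "mat_vec n A_mat (vec_diff n x (mat_vec n Gamma_mat y)) = vec_diff n (mat_vec n A_mat x) (mat_vec n (star_mat A_mat) y)"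
proof
  fix j
  show "mat_vec n A_mat (vec_diff n x (mat_vec n Gamma_mat y)) j = vec_diff n (mat_vec n A_mat x) (mat_vec n (star_mat A_mat) y) j"
  proof (cases "j \<le> n")
    case True
    have "(\<Sum>k\<le>n. A_mat j k * mat_vec n Gamma_mat y k) = (\<Sum>k\<le>n. \<Sum>l\<le>n. A_mat j k * Gamma_mat k l * y l)"
      by (intro sum.cong refl) (simp add: mat_vec_def sum_distrib_left mult.assoc)
    also have "\<dots> = (\<Sum>l\<le>n. star_mat A_mat j l * y l)"
      by (subst sum.swap) (simp add: sum_distrib_right[symmetric] A_mat_Gamma_mat[OF True])
    finally show ?thesis
      using True by (simp add: mat_vec_def[of n A_mat] mat_vec_def[of n "star_mat A_mat"] vec_diff_def right_diff_distrib sum_subtractf)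
  qed (simp add: mat_vec_def vec_diff_def)
qed

lemma scaled_kernel_1: "scaled_kernel n 1 = gauss_kernel n"
proof
  fix x
  have "gauss_kernel n (mat_vec n (T_mat 1) x) = gauss_kernel n x"
    unfolding gauss_kernel_def by (subst mat_vec_cong[of n "mat_vec n (T_mat 1) x" x A_mat]) (auto simp: mat_vec_T_mat)
  then show "scaled_kernel n 1 x = gauss_kernel n x" by (simp add: scaled_kernel_def)
qed

lemma scaled_kernel_pos: "0 < t \<Longrightarrow> 0 < scaled_kernel n t x"
  using K_const_pos[of n] by (simp add: scaled_kernel_def gauss_kernel_alt)

lemma gauss_kernel_continuous: "continuous_on UNIV (gauss_kernel n)"
  unfolding gauss_kernel_alt
  by (intro continuous_intros continuous_on_product_coordinates) simp

lemma scaled_kernel_shift_continuous: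
  assumes t: "0 < t"
  shows "continuous_on UNIV (\<lambda>(a, w). scaled_kernel n t (vec_diff n w (taylor_shift n t a)))"
proof -
  have fst: "continuous_on UNIV (\<lambda>p :: (nat \<Rightarrow> real) \<times> (nat \<Rightarrow> real). fst p k)"
    and snd: "continuous_on UNIV (\<lambda>p :: (nat \<Rightarrow> real) \<times> (nat \<Rightarrow> real). snd p k)" for k
    by (rule continuous_on_product_then_coordinatewise[OF continuous_on_fst[OF continuous_on_id]]
        continuous_on_product_then_coordinatewise[OF continuous_on_snd[OF continuous_on_id]])+
  have "continuous_on UNIV (\<lambda>p. mat_vec n (T_mat t) (vec_diff n (snd p) (taylor_shift n t (fst p))))"
  proof (rule continuous_on_coordinatewise_then_product)
    fix k
    show "continuous_on UNIV (\<lambda>p. mat_vec n (T_mat t) (vec_diff n (snd p) (taylor_shift n t (fst p))) k)"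
    proof (cases "k \<le> n")
      case True
      then show ?thesis
        by (auto simp: mat_vec_T_mat vec_diff_def taylor_shift_def intro!: continuous_intros fst snd)
    qed (simp add: mat_vec_def)
  qed
  from continuous_on_compose2[OF gauss_kernel_continuous this subset_UNIV]
  show ?thesis
    unfolding scaled_kernel_def case_prod_beta by (intro continuous_intros)
qed

lemma taylor_shift_measurable: "taylor_shift n t \<in> lborel_vec n \<rightarrow>\<^sub>M lborel_vec n"
proof -
  have "taylor_shift n t = triangular_map {..n} (\<lambda>k j. t ^ (k - j) / fact (k - j)) (\<lambda>_. 0)"
    by (simp add: taylor_shift_def triangular_map_def fun_eq_iff)
  then show ?thesis by (simp only:) (rule triangular_map_measurable, auto)
qed

lemma lborel_vec_component_measurable: "k \<le> n \<Longrightarrow> (\<lambda>x. x k) \<in> borel_measurable (lborel_vec n)"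
  using measurable_component_singleton[of k "{..n}" "\<lambda>_. lborel :: real measure"] by simp

lemma vec_diff_measurable:
  "(\<lambda>(a, w). vec_diff n w (taylor_shift n t a)) \<in> lborel_vec n \<Otimes>\<^sub>M lborel_vec n \<rightarrow>\<^sub>M lborel_vec n"
  unfolding vec_diff_def case_prod_beta
proof (rule measurable_restrict)
  fix k assume "k \<in> {..n}"
  then have k: "k \<le> n" by simp
  note [measurable] = lborel_vec_component_measurable[OF k] taylor_shift_measurable
  show "(\<lambda>p. snd p k - taylor_shift n t (fst p) k) \<in> lborel_vec n \<Otimes>\<^sub>M lborel_vec n \<rightarrow>\<^sub>M lborel"
    using measurable_compose[OF taylor_shift_measurable lborel_vec_component_measurable[OF k]]
    by simp
qed

lemma scaled_kernel_translate:
  fixes t :: real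
  assumes D[measurable]: "D \<in> sets (lborel_vec n)" and a: "a \<in> vecs n"
  defines "b \<equiv> taylor_shift n t a"
  shows "(\<integral>\<^sup>+v. ennreal (scaled_kernel n t v) * indicator D (\<lambda>k\<in>{..n}. b k + v k) \<partial>lborel_vec n)
    = (\<integral>\<^sup>+w\<in>D. scaled_kernel n t (vec_diff n w b) \<partial>lborel_vec n)"
proof -
  let ?I = "\<lambda>j k :: nat. if j = k then 1 else 0 :: real"
  have [measurable]: "scaled_kernel n t \<in> borel_measurable (lborel_vec n)" by (rule scaled_kernel_measurable)
  have [measurable]: "(\<lambda>v. \<lambda>k\<in>{..n}. b k + v k) \<in> lborel_vec n \<rightarrow>\<^sub>M lborel_vec n"
    using lborel_vec_component_measurable[of _ n] by (intro measurable_restrict) auto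
  \<comment> \<open>A translation is the triangular map with the identity matrix.\<close>
  have tri: "triangular_map {..n} ?I (\<lambda>k. - b k) w = vec_diff n w b" for w
    by (auto simp: triangular_map_def vec_diff_def fun_eq_iff if_distrib[of "\<lambda>x. x * _"] cong: if_cong)
  have "(\<integral>\<^sup>+v. ennreal (scaled_kernel n t v) * indicator D (\<lambda>k\<in>{..n}. b k + v k) \<partial>lborel_vec n)
    = (\<integral>\<^sup>+w. ennreal (scaled_kernel n t (vec_diff n w b)) * indicator D (\<lambda>k\<in>{..n}. b k + vec_diff n w b k) \<partial>lborel_vec n)"
    by (subst nn_integral_triangular_map[where L="?I" and b="\<lambda>k. - b k"]) (simp_all add: tri)
  also have "\<dots> = (\<integral>\<^sup>+w\<in>D. scaled_kernel n t (vec_diff n w b) \<partial>lborel_vec n)"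
  proof (intro nn_integral_cong)
    fix w assume "w \<in> space (lborel_vec n)"
    then have "(\<lambda>k\<in>{..n}. b k + vec_diff n w b k) = w"
      by (auto simp: vec_diff_def fun_eq_iff space_PiM PiE_iff extensional_def)
    then show "ennreal (scaled_kernel n t (vec_diff n w b)) * indicator D (\<lambda>k\<in>{..n}. b k + vec_diff n w b k)
      = ennreal (scaled_kernel n t (vec_diff n w b)) * indicator D w" by simp
  qed
  finally show ?thesis .
qed

context standard_brownian_motion
begin

lemma W_vec_measurable: "0 \<le> s \<Longrightarrow> W_vec B n s \<in> M \<rightarrow>\<^sub>M lborel_vec n"
  unfolding W_vec_def using iter_int_measurable by (intro measurable_restrict) auto

lemma char_state:
  assumes "0 \<le> s"
  shows "(CLINT \<omega>|M. iexp (\<Sum>k\<le>n. c k * iter_int B k s \<omega>)) = of_real (exp (- cov_form n s c / 2))"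
  using char_state_innovation[OF assms order_refl, where n=n and c=c and d="\<lambda>_. 0"] by (simp add: cov_form_zero del: of_real_sum)

lemma char_innovation:
  assumes "0 \<le> s" "0 \<le> t"
  shows "(CLINT \<omega>|M. iexp (\<Sum>k\<le>n. d k * innovation B s (s + t) k \<omega>)) = of_real (exp (- cov_form n t d / 2))"
  using char_state_innovation[OF assms, where n=n and c="\<lambda>_. 0" and d=d] by (simp add: cov_form_zero del: of_real_sum)

lemma distributed_W_vec:
  assumes "0 < s"
  shows "distributed M (lborel_vec n) (W_vec B n s) (scaled_kernel n s)"
proof -
  have "distributed M (lborel_vec n) (\<lambda>\<omega>. \<lambda>k\<in>{..n}. iter_int B k s \<omega>) (scaled_kernel n s)"
    using assms by (intro distributed_scaled_kernel iter_int_measurable char_state) auto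
  then show ?thesis by (simp add: W_vec_def[abs_def])
qed

text \<open>
  Stationarity comes from Brownian scaling: with \<open>e\<^sup>t\<close> for the time, \<open>X(t) = T(e\<^sup>t) W(e\<^sup>t)\<close> has the
  covariances of \<open>W(1)\<close>.
\<close>

lemma distributed_X_vec: "distributed M (lborel_vec n) (X_vec B n t) (gauss_kernel n)"
proof -
  have "distributed M (lborel_vec n) (\<lambda>\<omega>. \<lambda>k\<in>{..n}. exp (- (real k + 1/2) * t) * iter_int B k (exp t) \<omega>) (scaled_kernel n 1)"
  proof (rule distributed_scaled_kernel)
    fix c
    have "(CLINT \<omega>|M. iexp (\<Sum>k\<le>n. c k * (exp (- (real k + 1/2) * t) * iter_int B k (exp t) \<omega>)))
      = (CLINT \<omega>|M. iexp (\<Sum>k\<le>n. (c k * exp t powr (- (real k + 1/2))) * iter_int B k (exp t) \<omega>))"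
      by (simp add: exp_powr_real mult_ac del: of_real_sum)
    then show "(CLINT \<omega>|M. iexp (\<Sum>k\<le>n. c k * (exp (- (real k + 1/2) * t) * iter_int B k (exp t) \<omega>)))
      = of_real (exp (- cov_form n 1 c / 2))"
      by (simp only: char_state[OF exp_ge_zero] cov_form_scale[OF exp_gt_zero])
  qed (use iter_int_measurable in auto)
  then show ?thesis by (simp add: X_vec_def[abs_def] scaled_kernel_1)
qed

lemma is_stationary_density_gauss_kernel: "is_stationary_density M B n (gauss_kernel n)"
  unfolding is_stationary_density_def
  using distributed_X_vec[of n] continuous_on_subset[OF gauss_kernel_continuous subset_UNIV] K_const_pos[of n]
  by (auto simp: gauss_kernel_alt)

lemma W_vec_add: "W_vec B n (t + s) \<omega> = (\<lambda>k\<in>{..n}. taylor_shift n t (W_vec B n s \<omega>) k + innovation B s (s + t) k \<omega>)"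
  by (auto simp: W_vec_def taylor_shift_def innovation_def fun_eq_iff add.commute intro!: sum.cong)

lemma joint_law:
  assumes s: "0 \<le> s" and t: "0 < t"
  shows "distr M (lborel_vec n \<Otimes>\<^sub>M lborel_vec n) (\<lambda>\<omega>. (W_vec B n s \<omega>, \<lambda>k\<in>{..n}. innovation B s (s + t) k \<omega>))
    = distr M (lborel_vec n) (W_vec B n s) \<Otimes>\<^sub>M density (lborel_vec n) (scaled_kernel n t)"
proof -
  have st: "0 \<le> t" "s \<le> s + t" using t by auto
  have "distributed M (lborel_vec n) (\<lambda>\<omega>. \<lambda>k\<in>{..n}. innovation B s (s + t) k \<omega>) (scaled_kernel n t)"
    using s t by (intro distributed_scaled_kernel innovation_measurable char_innovation) auto
  then have V: "distr M (lborel_vec n) (\<lambda>\<omega>. \<lambda>k\<in>{..n}. innovation B s (s + t) k \<omega>) = density (lborel_vec n) (scaled_kernel n t)"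
    by (simp add: distributed_def)
  show ?thesis
    unfolding V[symmetric] W_vec_def
  proof (rule distr_pair_of_char)
    fix c d :: "nat \<Rightarrow> real"
    show "(CLINT \<omega>|M. iexp ((\<Sum>k\<le>n. c k * iter_int B k s \<omega>) + (\<Sum>k\<le>n. d k * innovation B s (s + t) k \<omega>)))
      = (CLINT \<omega>|M. iexp (\<Sum>k\<le>n. c k * iter_int B k s \<omega>)) * (CLINT \<omega>|M. iexp (\<Sum>k\<le>n. d k * innovation B s (s + t) k \<omega>))"
      unfolding char_state_innovation[OF s st(1)] char_state[OF s] char_innovation[OF s st(1)] of_real_mult[symmetric] exp_add[symmetric]
      by (simp add: add_divide_distrib)
  qed (use s st in \<open>auto intro: iter_int_measurable innovation_measurable prob_space_axioms\<close>)
qed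

text \<open>
  By \<open>W_vec_add\<close> the state at time \<open>t + s\<close> is the shifted state at time \<open>s\<close> plus the innovation, and
  by \<open>joint_law\<close> these two are independent. Fubini's theorem and translation invariance of Lebesgue
  measure then verify the defining property of the conditional probability on the events
  \<open>W(s) \<in> E\<close>.
\<close>

lemma is_transition_density_scaled_kernel:
  "is_transition_density M B n (\<lambda>a w t. scaled_kernel n t (vec_diff n w (taylor_shift n t a)))"
  unfolding is_transition_density_def
proof (intro allI impI conjI ballI)
  fix t :: real assume t: "0 < t"
  show "0 \<le> scaled_kernel n t (vec_diff n w (taylor_shift n t a))" for a w
    by (rule scaled_kernel_nonneg)
  show "continuous_on (vecs n \<times> vecs n) (\<lambda>(a, w). scaled_kernel n t (vec_diff n w (taylor_shift n t a)))"
    using scaled_kernel_shift_continuous[OF t] by (rule continuous_on_subset) simp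
  fix s :: real and D assume s: "0 \<le> s" and D[measurable]: "D \<in> sets (lborel_vec n)"
  let ?P = "lborel_vec n" and ?W = "W_vec B n s" and ?V = "\<lambda>\<omega>. \<lambda>k\<in>{..n}. innovation B s (s + t) k \<omega>"
  let ?F = "vimage_algebra (space M) ?W ?P"
  let ?\<pi> = "\<lambda>a w. scaled_kernel n t (vec_diff n w (taylor_shift n t a))"
  let ?g = "\<lambda>a. \<integral>\<^sup>+w\<in>D. ennreal (?\<pi> a w) \<partial>?P"
  let ?add = "\<lambda>a v. \<lambda>k\<in>{..n}. taylor_shift n t a k + v k"
  interpret product_sigma_finite "\<lambda>_::nat. lborel :: real measure" ..
  interpret P: sigma_finite_measure ?P by (rule sigma_finite) simp
  have [measurable]: "scaled_kernel n t \<in> borel_measurable ?P" by (rule scaled_kernel_measurable)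
  have W[measurable]: "?W \<in> M \<rightarrow>\<^sub>M ?P" using s by (rule W_vec_measurable)
  have V[measurable]: "?V \<in> M \<rightarrow>\<^sub>M ?P"
    using s t by (intro measurable_restrict) (auto intro: innovation_measurable)
  have Wts[measurable]: "W_vec B n (t + s) \<in> M \<rightarrow>\<^sub>M ?P" using s t by (intro W_vec_measurable) simp
  have W_space: "?W \<in> space M \<rightarrow> space ?P" using W by (rule measurable_space[THEN funcsetI])
  have "subalgebra M ?F"
    using measurable_sets[OF W] by (auto simp: subalgebra_def sets_vimage_algebra2[OF W_space])
  then interpret F: finite_measure_subalgebra M ?F by unfold_locales
  have add[measurable]: "(\<lambda>(a, v). ?add a v) \<in> ?P \<Otimes>\<^sub>M ?P \<rightarrow>\<^sub>M ?P"
    unfolding case_prod_beta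
  proof (rule measurable_restrict)
    fix k assume "k \<in> {..n}"
    then have [measurable]: "(\<lambda>x. x k) \<in> borel_measurable ?P" "(\<lambda>a. taylor_shift n t a k) \<in> borel_measurable ?P"
      using measurable_compose[OF taylor_shift_measurable lborel_vec_component_measurable] lborel_vec_component_measurable by auto
    show "(\<lambda>p. taylor_shift n t (fst p) k + snd p k) \<in> ?P \<Otimes>\<^sub>M ?P \<rightarrow>\<^sub>M lborel" by simp
  qed
  have "(\<lambda>(a, w). ?\<pi> a w) \<in> borel_measurable (?P \<Otimes>\<^sub>M ?P)"
    using measurable_compose[OF vec_diff_measurable scaled_kernel_measurable] by (simp add: case_prod_beta)
  then have [measurable]: "(\<lambda>(a, w). ennreal (?\<pi> a w) * indicator D w) \<in> borel_measurable (?P \<Otimes>\<^sub>M ?P)"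
    by (simp add: case_prod_beta)
  then have g[measurable]: "?g \<in> borel_measurable ?P"
    by (rule P.borel_measurable_nn_integral)
  have "AE \<omega> in M. ?g (?W \<omega>) = nn_cond_exp M ?F (indicator {\<omega>\<in>space M. W_vec B n (t + s) \<omega> \<in> D}) \<omega>"
  proof (rule F.nn_cond_exp_charact)
    show "(indicator {\<omega>\<in>space M. W_vec B n (t + s) \<omega> \<in> D} :: _ \<Rightarrow> ennreal) \<in> borel_measurable M" by measurable
    show "(\<lambda>\<omega>. ?g (?W \<omega>)) \<in> borel_measurable ?F"
      using measurable_compose[OF measurable_vimage_algebra1[OF W_space] g] .
    fix A assume "A \<in> sets ?F"
    then obtain E where E[measurable]: "E \<in> sets ?P" and A: "A = ?W -` E \<inter> space M"
      by (auto simp: sets_vimage_algebra2[OF W_space])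
    let ?h = "\<lambda>(a, v). indicator E a * indicator D (?add a v) :: ennreal"
    have D_ind[measurable]: "(\<lambda>(a, v). indicator D (?add a v) :: ennreal) \<in> borel_measurable (?P \<Otimes>\<^sub>M ?P)"
      using measurable_compose[OF add borel_measurable_indicator[OF D]] by (simp add: case_prod_beta)
    have h[measurable]: "?h \<in> borel_measurable (?P \<Otimes>\<^sub>M ?P)"
      using D_ind by (simp add: case_prod_beta)
    interpret Q: prob_space "density ?P (scaled_kernel n t)"
    proof -
      have "prob_space (distr M ?P ?V)" using V by (rule prob_space_distr)
      moreover have "distr M ?P ?V = density ?P (scaled_kernel n t)"
        using s t by (intro distributed_distr_eq_density distributed_scaled_kernel innovation_measurable char_innovation) auto
      ultimately show "prob_space (density ?P (scaled_kernel n t))" by simp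
    qed
    have "(\<integral>\<^sup>+\<omega>\<in>A. indicator {\<omega>\<in>space M. W_vec B n (t + s) \<omega> \<in> D} \<omega> \<partial>M) = (\<integral>\<^sup>+\<omega>. ?h (?W \<omega>, ?V \<omega>) \<partial>M)"
    proof (intro nn_integral_cong)
      fix \<omega> assume "\<omega> \<in> space M"
      moreover have "W_vec B n (t + s) \<omega> = ?add (?W \<omega>) (?V \<omega>)"
        unfolding W_vec_add by (auto simp: fun_eq_iff)
      ultimately show "indicator {\<omega>\<in>space M. W_vec B n (t + s) \<omega> \<in> D} \<omega> * indicator A \<omega> = ?h (?W \<omega>, ?V \<omega>)"
        by (auto simp: A split: split_indicator)
    qed
    also have "\<dots> = (\<integral>\<^sup>+p. ?h p \<partial>distr M (?P \<Otimes>\<^sub>M ?P) (\<lambda>\<omega>. (?W \<omega>, ?V \<omega>)))"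
      by (rule nn_integral_distr[symmetric]) measurable
    also have "\<dots> = (\<integral>\<^sup>+a. (\<integral>\<^sup>+v. ?h (a, v) \<partial>density ?P (scaled_kernel n t)) \<partial>distr M ?P ?W)"
      unfolding joint_law[OF s t]
      by (rule Q.nn_integral_fst[symmetric]) (simp add: h cong: measurable_cong_sets)
    also have "\<dots> = (\<integral>\<^sup>+a. indicator E a * ?g a \<partial>distr M ?P ?W)"
    proof (intro nn_integral_cong)
      fix a assume "a \<in> space (distr M ?P ?W)"
      then have a: "a \<in> vecs n" "a \<in> space ?P" by (auto simp: space_PiM)
      have D_a[measurable]: "(\<lambda>v. indicator D (?add a v) :: ennreal) \<in> borel_measurable ?P"
        using measurable_Pair2[OF D_ind a(2)] by simp
      have "(\<integral>\<^sup>+v. ?h (a, v) \<partial>density ?P (scaled_kernel n t)) = (\<integral>\<^sup>+v. ennreal (scaled_kernel n t v) * (indicator E a * indicator D (?add a v)) \<partial>?P)"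
        by (subst nn_integral_density) simp_all
      also have "\<dots> = indicator E a * (\<integral>\<^sup>+v. ennreal (scaled_kernel n t v) * indicator D (?add a v) \<partial>?P)"
        by (subst nn_integral_cmult[symmetric]) (auto simp: mult_ac)
      also have "\<dots> = indicator E a * ?g a"
        by (simp only: scaled_kernel_translate[OF D a(1)])
      finally show "(\<integral>\<^sup>+v. ?h (a, v) \<partial>density ?P (scaled_kernel n t)) = indicator E a * ?g a" .
    qed
    also have "\<dots> = (\<integral>\<^sup>+\<omega>. indicator E (?W \<omega>) * ?g (?W \<omega>) \<partial>M)"
      by (rule nn_integral_distr) measurable
    also have "\<dots> = (\<integral>\<^sup>+\<omega>\<in>A. ?g (?W \<omega>) \<partial>M)"
      by (intro nn_integral_cong) (auto simp: A split: split_indicator)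
    finally show "(\<integral>\<^sup>+\<omega>\<in>A. indicator {\<omega>\<in>space M. W_vec B n (t + s) \<omega> \<in> D} \<omega> \<partial>M) = (\<integral>\<^sup>+\<omega>\<in>A. ?g (?W \<omega>) \<partial>M)" .
  qed
  then show "AE \<omega> in M. nn_cond_exp M ?F (indicator {\<omega>\<in>space M. W_vec B n (t + s) \<omega> \<in> D}) \<omega> = ?g (?W \<omega>)"
    by eventually_elim simp
qed

lemma stationary_density_le:
  assumes p: "is_stationary_density M B n p" and q: "is_stationary_density M B n q" and x: "x \<in> vecs n"
  shows "p x \<le> q x"
proof (rule ccontr)
  assume "\<not> p x \<le> q x"
  then have less: "q x < p x" by simp
  have cont: "continuous_on (vecs n \<times> vecs n) (\<lambda>(a, w). f w)" if "continuous_on (vecs n) f" for f :: "(nat \<Rightarrow> real) \<Rightarrow> real"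
    unfolding case_prod_beta
    by (rule continuous_on_compose2[OF that continuous_on_snd[OF continuous_on_id]]) auto
  have pq: "0 \<le> q x" "continuous_on (vecs n) p" "continuous_on (vecs n) q"
    using p q x by (auto simp: is_stationary_density_def)
  have "distributed M (lborel_vec n) (X_vec B n 0) p" "distributed M (lborel_vec n) (X_vec B n 0) q"
    using p q by (auto simp: is_stationary_density_def)
  note law = this[THEN distributed_emeasure]
  show False
  proof (rule separating_boxes[where f="\<lambda>_. p" and g="\<lambda>_. q", OF cont[OF pq(2)] cont[OF pq(3)] pq(1) x x less])
    fix E D assume E: "0 < emeasure (lborel_vec n) E" and D: "D \<in> sets (lborel_vec n)"
      and sep: "\<And>b. b \<in> E \<Longrightarrow> (\<integral>\<^sup>+v\<in>D. ennreal (q v) \<partial>lborel_vec n) < (\<integral>\<^sup>+v\<in>D. ennreal (p v) \<partial>lborel_vec n)"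
    obtain b where "b \<in> E" using E by (cases "E = {}") auto
    from sep[OF this] show False
      unfolding law(1)[OF D, symmetric] law(2)[OF D, symmetric] by simp
  qed
qed

text \<open>
  On separating boxes \<open>E\<close> and \<open>D\<close>, both densities would compute the same conditional probability of
  \<open>W(t + 1) \<in> D\<close> given \<open>W(1)\<close>, so \<open>W(1)\<close> would almost surely avoid \<open>E\<close>. But the density of \<open>W(1)\<close> is
  positive everywhere and \<open>E\<close> has positive measure.
\<close>

lemma transition_density_le:
  assumes \<pi>: "is_transition_density M B n \<pi>" and \<rho>: "is_transition_density M B n \<rho>"
    and t: "0 < t" and a: "a \<in> vecs n" and w: "w \<in> vecs n"
  shows "\<pi> a w t \<le> \<rho> a w t"
proof (rule ccontr)
  assume "\<not> \<pi> a w t \<le> \<rho> a w t"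
  then have less: "\<rho> a w t < \<pi> a w t" by simp
  let ?P = "lborel_vec n"
  have cont: "continuous_on (vecs n \<times> vecs n) (\<lambda>(a, w). \<pi> a w t)" "continuous_on (vecs n \<times> vecs n) (\<lambda>(a, w). \<rho> a w t)"
    and nonneg: "0 \<le> \<rho> a w t"
    using \<pi> \<rho> t a w by (auto simp: is_transition_density_def)
  show False
  proof (rule separating_boxes[where f="\<lambda>a w. \<pi> a w t" and g="\<lambda>a w. \<rho> a w t", OF cont nonneg a w less])
    fix E D assume E: "E \<in> sets ?P" "0 < emeasure ?P E" and D: "D \<in> sets ?P"
      and sep: "\<And>b. b \<in> E \<Longrightarrow> (\<integral>\<^sup>+v\<in>D. ennreal (\<rho> b v t) \<partial>?P) < (\<integral>\<^sup>+v\<in>D. ennreal (\<pi> b v t) \<partial>?P)"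
    let ?C = "nn_cond_exp M (vimage_algebra (space M) (W_vec B n 1) ?P) (indicator {\<omega>\<in>space M. W_vec B n (t + 1) \<omega> \<in> D})"
    have "AE \<omega> in M. ?C \<omega> = (\<integral>\<^sup>+v\<in>D. ennreal (\<pi> (W_vec B n 1 \<omega>) v t) \<partial>?P)"
      "AE \<omega> in M. ?C \<omega> = (\<integral>\<^sup>+v\<in>D. ennreal (\<rho> (W_vec B n 1 \<omega>) v t) \<partial>?P)"
      using \<pi> \<rho> t D unfolding is_transition_density_def by (blast intro: zero_le_one)+
    then have "AE \<omega> in M. W_vec B n 1 \<omega> \<notin> E"
    proof eventually_elim
      case (elim \<omega>)
      then show ?case using sep[of "W_vec B n 1 \<omega>"] by auto
    qed
    then have "emeasure M (W_vec B n 1 -` E \<inter> space M) = 0"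
      using E(1) W_vec_measurable[of 1 n]
      by (subst (asm) AE_iff_measurable[OF _ refl]) (auto simp: vimage_def Int_def conj_commute intro: measurable_sets_Collect)
    then have "(\<integral>\<^sup>+x. ennreal (scaled_kernel n 1 x) * indicator E x \<partial>?P) = 0"
      using distributed_emeasure[OF distributed_W_vec[of 1 n] E(1)] by simp
    then have "AE x in ?P. ennreal (scaled_kernel n 1 x) * indicator E x = 0"
      using E(1) scaled_kernel_measurable[of n 1] by (subst (asm) nn_integral_0_iff_AE) auto
    then have "AE x in ?P. x \<notin> E"
    proof eventually_elim
      case (elim x)
      then show ?case using scaled_kernel_pos[of 1 n x] by (auto split: split_indicator_asm)
    qed
    then have "emeasure ?P E = 0"
      using E(1) sets.sets_into_space[OF E(1)] by (subst (asm) AE_iff_measurable[OF E(1)]) auto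
    with E(2) show False by simp
  qed
qed

end

theorem proposition5p2:
  fixes M :: "'a measure" and B :: "real \<Rightarrow> 'a \<Rightarrow> real" and n :: nat
  assumes "standard_brownian_motion M B"
  shows "(\<exists>p. is_stationary_density M B n p) \<and>
    (\<exists>\<pi>. is_transition_density M B n \<pi>) \<and>
    (\<forall>p \<pi>. is_stationary_density M B n p \<longrightarrow> is_transition_density M B n \<pi> \<longrightarrow>
      (\<forall>t>0. \<forall>a\<in>vecs n. \<forall>w\<in>vecs n.
        \<pi> a w t = t powr (- (1/2) * (real n + 1)\<^sup>2)
          * p (vec_diff n (mat_vec n (T_mat t) w) (mat_vec n Gamma_mat (mat_vec n (T_mat t) a))) \<and>
        \<pi> a w t = t powr (- (1/2) * (real n + 1)\<^sup>2) * K_const n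
          * (let v = vec_diff n (mat_vec n A_mat (mat_vec n (T_mat t) w))
                       (mat_vec n (star_mat A_mat) (mat_vec n (T_mat t) a))
             in exp (- (1/2) * vec_inner n v (mat_vec n Lambda_mat v)))))"
proof -
  interpret standard_brownian_motion M B by fact
  note p0 = is_stationary_density_gauss_kernel[of n] and \<pi>0 = is_transition_density_scaled_kernel[of n]
  have "\<pi> a w t = t powr (- (1/2) * (real n + 1)\<^sup>2)
        * p (vec_diff n (mat_vec n (T_mat t) w) (mat_vec n Gamma_mat (mat_vec n (T_mat t) a))) \<and>
      \<pi> a w t = t powr (- (1/2) * (real n + 1)\<^sup>2) * K_const n
        * (let v = vec_diff n (mat_vec n A_mat (mat_vec n (T_mat t) w))
                     (mat_vec n (star_mat A_mat) (mat_vec n (T_mat t) a))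
           in exp (- (1/2) * vec_inner n v (mat_vec n Lambda_mat v)))"
    if p: "is_stationary_density M B n p" and \<pi>: "is_transition_density M B n \<pi>"
      and t: "0 < t" and a: "a \<in> vecs n" and w: "w \<in> vecs n" for p \<pi> t a w
  proof
    let ?x = "vec_diff n (mat_vec n (T_mat t) w) (mat_vec n Gamma_mat (mat_vec n (T_mat t) a))"
    have "?x \<in> vecs n" by (auto simp: vec_diff_def)
    then have px: "p ?x = gauss_kernel n ?x"
      using stationary_density_le[OF p p0] stationary_density_le[OF p0 p] by (intro antisym)
    have "\<pi> a w t = scaled_kernel n t (vec_diff n w (taylor_shift n t a))"
      using transition_density_le[OF \<pi> \<pi>0 t a w] transition_density_le[OF \<pi>0 \<pi> t a w] by (rule antisym)
    also have "\<dots> = t powr (- (1/2) * (real n + 1)\<^sup>2) * gauss_kernel n ?x"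
      by (rule scaled_kernel_shift[OF t])
    finally have eq: "\<pi> a w t = t powr (- (1/2) * (real n + 1)\<^sup>2) * gauss_kernel n ?x" .
    show "\<pi> a w t = t powr (- (1/2) * (real n + 1)\<^sup>2) * p ?x"
      by (simp only: eq px)
    show "\<pi> a w t = t powr (- (1/2) * (real n + 1)\<^sup>2) * K_const n
          * (let v = vec_diff n (mat_vec n A_mat (mat_vec n (T_mat t) w))
                       (mat_vec n (star_mat A_mat) (mat_vec n (T_mat t) a))
             in exp (- (1/2) * vec_inner n v (mat_vec n Lambda_mat v)))"
      unfolding eq gauss_kernel_def mat_vec_A_vec_diff_Gamma by (simp add: mult.assoc)
  qed
  then have "\<forall>p \<pi>. is_stationary_density M B n p \<longrightarrow> is_transition_density M B n \<pi> \<longrightarrow>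
      (\<forall>t>0. \<forall>a\<in>vecs n. \<forall>w\<in>vecs n.
        \<pi> a w t = t powr (- (1/2) * (real n + 1)\<^sup>2)
          * p (vec_diff n (mat_vec n (T_mat t) w) (mat_vec n Gamma_mat (mat_vec n (T_mat t) a))) \<and>
        \<pi> a w t = t powr (- (1/2) * (real n + 1)\<^sup>2) * K_const n
          * (let v = vec_diff n (mat_vec n A_mat (mat_vec n (T_mat t) w))
                       (mat_vec n (star_mat A_mat) (mat_vec n (T_mat t) a))
             in exp (- (1/2) * vec_inner n v (mat_vec n Lambda_mat v))))"
    by (intro allI impI ballI)
  moreover have "\<exists>p. is_stationary_density M B n p" by (rule exI, rule p0)
  moreover have "\<exists>\<pi>. is_transition_density M B n \<pi>" by (rule exI, rule \<pi>0)
  ultimately show ?thesis by (intro conjI)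
qed

end
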